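(* Suppose that, for some $\rho > 0$, $e^{\rho|x|}q(x) \in W^{1,\infty}(\mathbf{R};\mathbf{R})$. Consider the system $$\psi_t(x,t) = i\omega\,\psi(x,t) + \omega\, a(t)\, q(x-t), \qquad \dot a(t) = -\frac{1}{\omega}\int_{\mathbf{R}} \Re[\psi(x,t)]\, q(x-t)\,dx. \qquad ( * )$$ (1) The solution of $( * )$ with initial data $\psi(x,0) = 0$ and $a(0) = a_0 \in \mathbf{R}$ satisfies, for all $\omega$ sufficiently large, $$a(t) = a_0\, r_\omega\, e^{-\theta_\omega t} + b_\omega(t)\qquad (t\ge 0),$$ where $\theta_\omega = 2\pi^2|\hat q(\omega)|^2(1+\mathcal{O}(1/\omega))$, $r_\omega = 1 + \mathcal{O}(1/\omega)$, and $\|b_\omega\|_{\rho'} < \infty$ for any $\rho' < \rho/2$. Here $\theta_\omega$ and $r_\omega$ are real numbers depending on $q$ and $\omega$ but not on $a_0$. (2) Additionally, if $e^{\rho|x|}\psi_0(x) \in L^\infty(\mathbf{R};\mathbf{C})$, then the solution of $( * )$ with initial data $\psi(x,0) = \psi_0(x)$ and $a(0) = a_0\in\mathbf{R}$ satisfies, for all $\omega$ sufficiently large, $$a(t) = \alpha\, e^{-\theta_\omega t} + b_\omega(t)\qquad (t\ge 0)$$ for some constant $\alpha = \alpha(\psi_0,a_0) \in \mathbf{R}$, with the same $\theta_\omega$ as in (1), and where (the possibly different function) $b_\omega$ again satisfies $\|b_\omega\|_{\rho'} < \infty$ for any $\rho' < \rho/2$.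
   Context: The unknowns are $\psi(x,t)\in\mathbf{C}$ and $a(t)\in\mathbf{R}$, for $x,t\in\mathbf{R}$; $\omega>0$ is a parameter. For $q\in L^2(\mathbf{R};\mathbf{R})$, $\psi_0\in L^2(\mathbf{R};\mathbf{C})$ and $a_0\in\mathbf{R}$, "the solution" is the unique $(\psi,a)\in C^1(\mathbf{R};L^2(\mathbf{R};\mathbf{C})\times\mathbf{R})$ satisfying the system with the given initial data. For $f:\mathbf{R}^+\to\mathbf{C}$ and a real number $\rho'$, $\|f\|_{\rho'} := \sup_{t\ge 0} e^{\rho' t}|f(t)|$. The Fourier transform is $\hat f(k) := \frac{1}{2\pi}\int_{\mathbf{R}} e^{-ikx}f(x)\,dx$. The number $\theta_\omega$ is defined as follows: let $(q\star q)(t) := \int_{\mathbf{R}} q(x+t)q(x)\,dx$, $K_\omega(z) := \int_0^\infty e^{-zt}\cos(\omega t)\,(q\star q)(t)\,dt$, and $V_\omega(z) := 1/(z+K_\omega(z))$; for $\omega$ sufficiently large $V_\omega$ has exactly one pole in $\{\Re(z)\ge -\rho/2\}$, which is real and simple, and $-\theta_\omega$ denotes its location. The notation $\mathcal{O}(1/\omega)$ denotes a quantity bounded in absolute value by $C/\omega$ for all sufficiently large $\omega$, with $C$ independent of $\omega$. *)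

theory Defs
  imports
    "HOL-Complex_Analysis.Complex_Analysis"
    "HOL-Library.Landau_Symbols"
begin

text \<open>
  Elements of \<open>L\<^sup>\<infinity>\<close>, \<open>W\<^sup>1\<^sup>,\<^sup>\<infinity>\<close> and \<open>L\<^sup>2\<close> are represented by Lebesgue measurable functions;
  equality in these spaces is equality almost everywhere.
\<close>

definition Linf :: "(real \<Rightarrow> 'a::real_normed_vector) \<Rightarrow> bool" where
  "Linf f \<longleftrightarrow> f \<in> borel_measurable lebesgue \<and> (\<exists>C. AE x in lebesgue. norm (f x) \<le> C)"

definition test_fun :: "(real \<Rightarrow> real) \<Rightarrow> bool" where
  "test_fun \<phi> \<longleftrightarrow>
     (\<forall>n. ((deriv ^^ n) \<phi>) differentiable_on UNIV) \<and> compact (closure {x. \<phi> x \<noteq> 0})"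

text \<open>To be used for \<open>f\<close> and \<open>g\<close> locally integrable, so that both integrals exist.\<close>

definition weak_deriv :: "(real \<Rightarrow> real) \<Rightarrow> (real \<Rightarrow> real) \<Rightarrow> bool" where
  "weak_deriv f g \<longleftrightarrow>
     (\<forall>\<phi>. test_fun \<phi> \<longrightarrow>
        (LINT x|lebesgue. f x * deriv \<phi> x) = - (LINT x|lebesgue. g x * \<phi> x))"

definition W1inf :: "(real \<Rightarrow> real) \<Rightarrow> bool" where
  "W1inf f \<longleftrightarrow> Linf f \<and> (\<exists>g. Linf g \<and> weak_deriv f g)"

definition L2 :: "(real \<Rightarrow> complex) \<Rightarrow> bool" where
  "L2 f \<longleftrightarrow> f \<in> borel_measurable lebesgue \<and> integrable lebesgue (\<lambda>x. (norm (f x))\<^sup>2)"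

definition L2norm :: "(real \<Rightarrow> complex) \<Rightarrow> real" where
  "L2norm f = sqrt (LINT x|lebesgue. (norm (f x))\<^sup>2)"

text \<open>
  A curve \<open>u\<close> in \<open>L\<^sup>2\<close> maps the time \<open>t\<close> to a representative \<open>u t\<close>. The predicate says that
  \<open>u\<close> belongs to \<open>C\<^sup>1(\<real>; L\<^sup>2)\<close> with derivative \<open>u'\<close>, all limits being taken in the norm of \<open>L\<^sup>2\<close>.
\<close>

definition C1_L2 :: "(real \<Rightarrow> real \<Rightarrow> complex) \<Rightarrow> (real \<Rightarrow> real \<Rightarrow> complex) \<Rightarrow> bool" where
  "C1_L2 u u' \<longleftrightarrow>
     (\<forall>t. L2 (u t) \<and> L2 (u' t)) \<and>
     (\<forall>t. ((\<lambda>h. L2norm (\<lambda>x. (u (t + h) x - u t x) / of_real h - u' t x)) \<longlongrightarrow> 0) (at 0)) \<and>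
     (\<forall>t. ((\<lambda>s. L2norm (\<lambda>x. u' s x - u' t x)) \<longlongrightarrow> 0) (at t))"

text \<open>
  Here \<open>\<psi> t\<close> is the function usually written \<open>\<psi>(\<cdot>, t)\<close>: time is the first argument.
\<close>

definition is_solution ::
  "(real \<Rightarrow> real) \<Rightarrow> real \<Rightarrow> (real \<Rightarrow> complex) \<Rightarrow> real \<Rightarrow>
   (real \<Rightarrow> real \<Rightarrow> complex) \<Rightarrow> (real \<Rightarrow> real) \<Rightarrow> bool" where
  "is_solution q \<omega> \<psi>\<^sub>0 a\<^sub>0 \<psi> a \<longleftrightarrow>
     (\<exists>\<psi>' a'.
        C1_L2 \<psi> \<psi>' \<and>
        (\<forall>t. (a has_real_derivative a' t) (at t)) \<and> continuous_on UNIV a' \<and>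
        (\<forall>t. AE x in lebesgue.
           \<psi>' t x = \<i> * of_real \<omega> * \<psi> t x + of_real (\<omega> * a t * q (x - t))) \<and>
        (\<forall>t. a' t = - (1 / \<omega>) * (LINT x|lebesgue. Re (\<psi> t x) * q (x - t)))) \<and>
     (AE x in lebesgue. \<psi> 0 x = \<psi>\<^sub>0 x) \<and> a 0 = a\<^sub>0"

definition fourier :: "(real \<Rightarrow> complex) \<Rightarrow> real \<Rightarrow> complex" where
  "fourier f k = 1 / (2 * of_real pi) * (LINT x|lebesgue. exp (- \<i> * of_real (k * x)) * f x)"

definition wnorm :: "real \<Rightarrow> (real \<Rightarrow> 'a::real_normed_vector) \<Rightarrow> ennreal" where
  "wnorm \<rho>' f = (SUP t\<in>{0..}. ennreal (exp (\<rho>' * t) * norm (f t)))"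

definition autocorr :: "(real \<Rightarrow> real) \<Rightarrow> real \<Rightarrow> real" where
  "autocorr q t = (LINT x|lebesgue. q (x + t) * q x)"

definition K :: "(real \<Rightarrow> real) \<Rightarrow> real \<Rightarrow> complex \<Rightarrow> complex" where
  "K q \<omega> z = (LINT t:{0..}|lebesgue. exp (- z * of_real t) * of_real (cos (\<omega> * t) * autocorr q t))"

definition V :: "(real \<Rightarrow> real) \<Rightarrow> real \<Rightarrow> complex \<Rightarrow> complex" where
  "V q \<omega> z = 1 / (z + K q \<omega> z)"

definition is_theta :: "(real \<Rightarrow> real) \<Rightarrow> real \<Rightarrow> real \<Rightarrow> real \<Rightarrow> bool" where
  "is_theta q \<rho> \<omega> \<theta> \<longleftrightarrow>
     {z. Re z \<ge> - \<rho> / 2 \<and> is_pole (V q \<omega>) z} = {- of_real \<theta>} \<and>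
     isolated_singularity_at (V q \<omega>) (- of_real \<theta>) \<and>
     zorder (V q \<omega>) (- of_real \<theta>) = -1"

text \<open>Unspecified unless \<open>V q \<omega>\<close> has exactly one pole in the half plane and it is real and simple.\<close>

definition theta :: "(real \<Rightarrow> real) \<Rightarrow> real \<Rightarrow> real \<Rightarrow> real" where
  "theta q \<rho> \<omega> = (THE \<theta>. is_theta q \<rho> \<omega> \<theta>)"

end

(* Eliminating \<psi> by Duhamel's formula turns the system into the Volterra equation
   a' = g - k * a with k(t) = cos(\<omega> t) (q \<star> q)(t), whose Laplace symbol is z + K(z).
   Since q is Lipschitz with exponential weight, shifting by half a period shows that K and its
   divided differences are O(1/\<omega>); hence z + K(z) has a real zero -\<theta> near 0, and
   z + K(z) = (z + \<theta>) (1 - M(z)), where M is the Laplace transform of an exponentially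
   decaying function m of size O(1/\<omega>).  This factorization gives the uniqueness of the pole,
   and at z = 0 the formula \<theta> = K(0) / (1 - M(0)) with K(0) = 2 \<pi>^2 |q^(\<omega>)|^2.
   On the side of the equation, u = a - m * a satisfies u' = g - \<theta> u, so u is an exponential
   up to a fast decaying term, and because m is small in a weighted L^1 norm the equation
   a - m * a = u can be inverted without leaving the class of exponentially decaying
   perturbations.  No inversion of the Laplace transform is needed. *)
theory Submission
  imports Defs
begin

subsection \<open>Bump functions\<close>

definition flat :: "real poly \<Rightarrow> real \<Rightarrow> real" where
  "flat P x = (if x > 0 then poly P (1 / x) * exp (- (1 / x)) else 0)"

lemma poly_times_exp_neg_tendsto_0: "((\<lambda>y::real. poly P y * exp (- y)) \<longlongrightarrow> 0) at_top"
proof -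
  have "((\<lambda>y::real. \<Sum>i\<le>degree P. coeff P i * (y ^ i / exp y)) \<longlongrightarrow> (\<Sum>i\<le>degree P. coeff P i * 0)) at_top"
    by (intro tendsto_intros tendsto_power_div_exp_0)
  then show ?thesis
    by (simp add: poly_altdef exp_minus sum_divide_distrib divide_inverse sum_distrib_right mult.assoc)
qed

lemma flat_div_tendsto_0: "((\<lambda>x. flat P x / x) \<longlongrightarrow> 0) (at 0)"
proof (rule filterlim_split_at)
  have "((\<lambda>x. poly (P * [:0,1:]) (inverse x) * exp (- inverse x)) \<longlongrightarrow> 0) (at_right 0)"
    by (rule filterlim_compose[OF poly_times_exp_neg_tendsto_0 filterlim_inverse_at_top_right])
  then show "((\<lambda>x. flat P x / x) \<longlongrightarrow> 0) (at_right 0)"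
    by (rule Lim_transform_eventually)
      (auto simp: flat_def eventually_at_filter field_simps)
  show "((\<lambda>x. flat P x / x) \<longlongrightarrow> 0) (at_left 0)"
    by (rule tendsto_eventually) (auto simp: flat_def eventually_at_filter)
qed

lemma flat_has_derivative:
  "(flat P has_real_derivative flat ([:0,0,1:] * (P - pderiv P)) x) (at x)"
proof -
  consider "x < 0" | "x = 0" | "x > 0" by linarith
  then show ?thesis
  proof cases
    case 1
    have "((\<lambda>x. 0) has_real_derivative 0) (at x)" by simp
    then have "(flat P has_real_derivative 0) (at x)"
      by (rule DERIV_cong_ev[THEN iffD1, rotated -1])
        (use 1 in \<open>auto simp: flat_def intro!: eventually_mono[OF eventually_nhds_in_open[of "{..<0}"]]\<close>)
    then show ?thesis using 1 by (simp add: flat_def)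
  next
    case 2
    then show ?thesis
      using flat_div_tendsto_0[of P] by (simp add: DERIV_def flat_def)
  next
    case 3
    have "((\<lambda>x. poly P (1 / x) * exp (- (1 / x))) has_real_derivative
        flat ([:0,0,1:] * (P - pderiv P)) x) (at x)"
      using 3 by (auto intro!: derivative_eq_intros poly_DERIV[THEN DERIV_chain2] simp: flat_def field_simps power2_eq_square)
    then show ?thesis
      by (rule DERIV_cong_ev[THEN iffD1, rotated -1])
        (use 3 in \<open>auto simp: flat_def intro!: eventually_mono[OF eventually_nhds_in_open[of "{0<..}"]]\<close>)
  qed
qed

inductive_set flat_span :: "(real \<Rightarrow> real) set" where
  flat_span_prod: "(\<lambda>x. flat P (c * x + d) * flat Q (c' * x + d')) \<in> flat_span"
| flat_span_lincomb: "f \<in> flat_span \<Longrightarrow> g \<in> flat_span \<Longrightarrow> (\<lambda>x. u * f x + v * g x) \<in> flat_span"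

lemma flat_span_derivative:
  assumes "f \<in> flat_span"
  shows "\<exists>f'\<in>flat_span. \<forall>x. (f has_real_derivative f' x) (at x)"
  using assms
proof induction
  case (flat_span_prod P c d Q c' d')
  let ?D = "\<lambda>P. [:0,0,1:] * (P - pderiv P)"
  let ?f' = "\<lambda>x. c * (flat (?D P) (c * x + d) * flat Q (c' * x + d'))
     + c' * (flat P (c * x + d) * flat (?D Q) (c' * x + d'))"
  have "?f' \<in> flat_span"
    by (intro flat_span.intros)
  moreover have "((\<lambda>x. flat P (c * x + d) * flat Q (c' * x + d')) has_real_derivative ?f' x) (at x)" for x
    by (rule derivative_eq_intros DERIV_chain2[OF flat_has_derivative] refl)+ (simp add: algebra_simps)
  ultimately show ?case by (intro bexI[of _ ?f'] allI)
next
  case (flat_span_lincomb f g u v)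
  then obtain f' g' where *: "f' \<in> flat_span" "\<And>x. (f has_real_derivative f' x) (at x)"
    "g' \<in> flat_span" "\<And>x. (g has_real_derivative g' x) (at x)" by blast
  have "(\<lambda>x. u * f' x + v * g' x) \<in> flat_span"
    using * by (intro flat_span.intros)
  moreover have "((\<lambda>x. u * f x + v * g x) has_real_derivative u * f' x + v * g' x) (at x)" for x
    by (rule derivative_eq_intros * refl)+ simp
  ultimately show ?case by (intro bexI[of _ "\<lambda>x. u * f' x + v * g' x"] allI)
qed

lemma flat_span_deriv: "f \<in> flat_span \<Longrightarrow> deriv f \<in> flat_span"
  using flat_span_derivative[of f] DERIV_imp_deriv by (metis ext)

lemma flat_span_smooth: "f \<in> flat_span \<Longrightarrow> ((deriv ^^ n) f) differentiable_on UNIV"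
proof (induction n arbitrary: f)
  case 0
  then show ?case using flat_span_derivative[of f]
    by (auto simp: differentiable_on_def real_differentiable_def)
next
  case (Suc n)
  from Suc.IH[OF flat_span_deriv[OF Suc.prems]] show ?case
    by (simp add: funpow_swap1)
qed

definition bump :: "real \<Rightarrow> real \<Rightarrow> nat \<Rightarrow> real \<Rightarrow> real" where
  "bump a b n x = flat 1 (real n * (x - a)) * flat 1 (real n * (b - x))"

lemma bump_in_flat_span: "bump a b n \<in> flat_span"
  using flat_span_prod[of 1 "real n" "- real n * a" 1 "- real n" "real n * b"]
  by (simp add: bump_def[abs_def] algebra_simps)

lemma bump_shift_in_flat_span: "(\<lambda>x. bump a b n (x - h)) \<in> flat_span"
  using flat_span_prod[of 1 "real n" "- real n * (a + h)" 1 "- real n" "real n * (b + h)"]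
  by (simp add: bump_def[abs_def] algebra_simps)

lemma continuous_bump: "continuous_on UNIV (bump a b n)"
  using flat_span_derivative[OF bump_in_flat_span]
  by (meson DERIV_isCont continuous_at_imp_continuous_on)

lemma bump_zero: "x \<notin> {a<..<b} \<Longrightarrow> bump a b n x = 0"
  by (auto simp: bump_def flat_def zero_less_mult_iff)

lemma bump_bounds: "0 \<le> bump a b n x" "bump a b n x \<le> indicator {a<..<b} x"
proof -
  have *: "0 \<le> flat 1 x" "flat 1 x \<le> 1" for x by (auto simp: flat_def)
  show "0 \<le> bump a b n x" by (simp add: bump_def *)
  have "bump a b n x \<le> 1" unfolding bump_def by (intro mult_le_one *)
  then show "bump a b n x \<le> indicator {a<..<b} x"
    using bump_zero[of x a b n] by (auto simp: indicator_def)
qed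

lemma bump_tendsto: "(\<lambda>n. bump a b n x) \<longlonglongrightarrow> indicator {a<..<b} x"
proof (cases "x \<in> {a<..<b}")
  case True
  have *: "(\<lambda>n. flat 1 (real n * c)) \<longlonglongrightarrow> 1" if "c > 0" for c
  proof -
    have "(\<lambda>n. exp (- ((1 / real n) * (1 / c)))) \<longlonglongrightarrow> exp (- (0 * (1 / c)))"
      by (intro tendsto_intros lim_1_over_n)
    then have "(\<lambda>n. exp (- (1 / (real n * c)))) \<longlonglongrightarrow> 1" by simp
    then show ?thesis
      by (rule Lim_transform_eventually)
        (use that in \<open>auto simp: flat_def intro!: eventually_mono[OF eventually_gt_at_top[of 0]]\<close>)
  qed
  have "(\<lambda>n. bump a b n x) \<longlonglongrightarrow> 1 * 1"
    unfolding bump_def using True by (intro tendsto_mult *) auto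
  then show ?thesis using True by simp
qed (simp add: bump_zero)

lemma test_fun_window:
  fixes a b h :: real and n :: nat
  assumes h: "h > 0"
  defines "\<phi> \<equiv> \<lambda>y. integral {y - h..y} (bump a b n)"
  shows "test_fun \<phi>" "deriv \<phi> = (\<lambda>y. bump a b n y - bump a b n (y - h))"
    "\<And>y. y \<notin> {a..b + h} \<Longrightarrow> \<phi> y = 0"
proof -
  obtain X where X: "\<And>x. (X has_real_derivative bump a b n x) (at x)"
    using einterval_antiderivative[of "-\<infinity>" \<infinity> "bump a b n"] continuous_bump[of a b n]
    by (auto simp: continuous_on_eq_continuous_at has_real_derivative_iff_has_vector_derivative)
  have \<phi>: "\<phi> = (\<lambda>y. X y - X (y - h))"
  proof
    fix y
    have "(bump a b n has_integral X y - X (y - h)) {y - h..y}"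
      using h X by (intro fundamental_theorem_of_calculus)
        (auto simp: has_real_derivative_iff_has_vector_derivative[symmetric] intro: DERIV_subset)
    then show "\<phi> y = X y - X (y - h)" unfolding \<phi>_def by (rule integral_unique)
  qed
  have D: "(\<phi> has_real_derivative bump a b n y - bump a b n (y - h)) (at y)" for y
    unfolding \<phi> by (rule derivative_eq_intros DERIV_chain2[OF X] X refl)+ simp
  show dphi: "deriv \<phi> = (\<lambda>y. bump a b n y - bump a b n (y - h))"
    using D by (auto intro!: DERIV_imp_deriv)
  show z: "\<phi> y = 0" if "y \<notin> {a..b + h}" for y
  proof -
    have "integral {y - h..y} (bump a b n) = integral {y - h..y} (\<lambda>x. 0)"
      using that by (intro integral_cong bump_zero) auto
    then show ?thesis by (simp add: \<phi>_def)
  qed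
  have "bounded (closure {x. \<phi> x \<noteq> 0})"
    by (intro bounded_closure bounded_subset[OF bounded_closed_interval[of a "b + h"]] subsetI) (metis z mem_Collect_eq)
  then have "compact (closure {x. \<phi> x \<noteq> 0})" by (simp add: compact_eq_bounded_closed)
  moreover have "((deriv ^^ k) \<phi>) differentiable_on UNIV" for k
  proof (cases k)
    case 0
    then show ?thesis using D by (auto simp: differentiable_on_def real_differentiable_def)
  next
    case (Suc j)
    have "(\<lambda>y. 1 * bump a b n y + (- 1) * bump a b n (y - h)) \<in> flat_span"
      by (intro flat_span_lincomb bump_in_flat_span bump_shift_in_flat_span)
    then have "(deriv ^^ j) (deriv \<phi>) differentiable_on UNIV"
      unfolding dphi by (intro flat_span_smooth) simp
    then show ?thesis by (simp add: Suc funpow_swap1)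
  qed
  ultimately show "test_fun \<phi>" by (simp add: test_fun_def)
qed

lemma AE_zero_if_integral_Ioi_zero:
  fixes f :: "real \<Rightarrow> real"
  assumes f: "integrable lborel f"
    and 0: "\<And>c. (LINT x:{c<..}|lborel. f x) = 0"
  shows "AE x in lborel. f x = 0"
proof -
  have [measurable]: "f \<in> borel_measurable borel" using f by (simp add: borel_measurable_integrable)
  let ?P = "\<lambda>x. max 0 (f x)" and ?N = "\<lambda>x. max 0 (- f x)"
  have iP: "integrable lborel (\<lambda>x. indicator {c<..} x * ?P x)" and iN: "integrable lborel (\<lambda>x. indicator {c<..} x * ?N x)" for c
    by (rule Bochner_Integration.integrable_bound[OF f], auto simp: indicator_def)+
  have eP: "emeasure (density lborel (\<lambda>x. ennreal (?P x))) {c<..} = ennreal (LINT x|lborel. indicator {c<..} x * ?P x)" for c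
    by (subst emeasure_density, simp, simp, subst nn_integral_eq_integral[OF iP, symmetric])
      (auto simp: indicator_def intro!: nn_integral_cong)
  have eN: "emeasure (density lborel (\<lambda>x. ennreal (?N x))) {c<..} = ennreal (LINT x|lborel. indicator {c<..} x * ?N x)" for c
    by (subst emeasure_density, simp, simp, subst nn_integral_eq_integral[OF iN, symmetric])
      (auto simp: indicator_def intro!: nn_integral_cong)
  have eq: "(LINT x|lborel. indicator {c<..} x * ?P x) = (LINT x|lborel. indicator {c<..} x * ?N x)" for c
  proof -
    have "(LINT x|lborel. indicator {c<..} x * ?P x) - (LINT x|lborel. indicator {c<..} x * ?N x)
      = (LINT x|lborel. indicator {c<..} x * ?P x - indicator {c<..} x * ?N x)"
      by (rule Bochner_Integration.integral_diff[symmetric, OF iP iN])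
    also have "\<dots> = (LINT x:{c<..}|lborel. f x)"
      unfolding set_lebesgue_integral_def by (rule Bochner_Integration.integral_cong) (auto simp: indicator_def max_def)
    finally show ?thesis using 0[of c] by simp
  qed
  have "density lborel (\<lambda>x. ennreal (?P x)) = density lborel (\<lambda>x. ennreal (?N x))"
    by (rule measure_eqI_lessThan) (simp_all add: eP eN eq)
  then have "AE x in lborel. ennreal (?P x) = ennreal (?N x)"
    by (intro sigma_finite_measure.density_unique[OF lborel.sigma_finite_measure_axioms]) auto
  then show ?thesis
    by eventually_elim (auto simp: max_def split: if_splits)
qed

subsection \<open>Lipschitz representatives\<close>

lemma Linf_borel_representative:
  fixes f :: "real \<Rightarrow> real"
  assumes "Linf f"
  obtains g B where "g \<in> borel_measurable borel" "AE x in lebesgue. f x = g x"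
    "\<And>x. \<bar>g x\<bar> \<le> B" "B \<ge> 0"
proof -
  obtain C where f: "f \<in> borel_measurable lebesgue" "AE x in lebesgue. \<bar>f x\<bar> \<le> C"
    using assms by (auto simp: Linf_def)
  obtain g' where g': "g' \<in> borel_measurable lborel" "AE x in lborel. f x = g' x"
    using completion_ex_borel_measurable_real[OF f(1)] by blast
  define g where "g x = (if \<bar>g' x\<bar> \<le> C then g' x else 0)" for x
  have [measurable]: "g' \<in> borel_measurable borel" using g'(1) by simp
  have "g \<in> borel_measurable borel" unfolding g_def[abs_def] by measurable
  moreover have "AE x in lebesgue. f x = g x"
    using AE_completion[OF g'(2)] f(2) by eventually_elim (auto simp: g_def)
  moreover have "\<bar>g x\<bar> \<le> max C 0" for x by (auto simp: g_def)
  ultimately show ?thesis using that[of g "max C 0"] by auto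
qed

text \<open>The weak derivative is tested against \<open>y \<mapsto> \<integral>\<^bsub>y-h\<^esub>\<^bsup>y\<^esup> \<chi>\<close> with bumps \<open>\<chi>\<close> that approximate the indicator
  function of an interval.\<close>

lemma W1inf_increment:
  fixes p g :: "real \<Rightarrow> real"
  assumes [measurable]: "p \<in> borel_measurable borel" "g \<in> borel_measurable borel"
    and p: "\<And>x. \<bar>p x\<bar> \<le> B" and g: "\<And>x. \<bar>g x\<bar> \<le> G"
    and wd: "weak_deriv p g" and h: "h > 0"
  shows "AE x in lborel. p (x + h) - p x = (LINT y:{x..x + h}|lborel. g y)"
proof -
  define \<Gamma> where "\<Gamma> x = (LINT y:{x..x + h}|lborel. g y)" for x
  define D where "D x = p (x + h) - p x - \<Gamma> x" for x
  have G: "G \<ge> 0" and B: "B \<ge> 0" using g[of 0] p[of 0] by linarith+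
  have \<Gamma>_m[measurable]: "\<Gamma> \<in> borel_measurable borel"
  proof -
    have "(\<lambda>x. LINT y|lborel. (if x \<le> y \<and> y \<le> x + h then g y else 0)) \<in> borel_measurable lborel"
      by measurable
    moreover have "\<Gamma> = (\<lambda>x. LINT y|lborel. (if x \<le> y \<and> y \<le> x + h then g y else 0))"
      by (auto simp: \<Gamma>_def[abs_def] set_lebesgue_integral_def indicator_def intro!: Bochner_Integration.integral_cong ext)
    ultimately show ?thesis by simp
  qed
  have int: "integrable lborel (\<lambda>x. f x :: real)"
    if "f \<in> borel_measurable borel" "\<And>x. \<bar>f x\<bar> \<le> M * indicator {a..b} x" for f M and a b :: real
  proof (rule Bochner_Integration.integrable_bound)
    show "integrable lborel (\<lambda>x. M * indicator {a..b} x)"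
      by (intro integrable_mult_right integrable_real_indicator) (simp_all add: emeasure_lborel_Icc_eq)
    show "AE x in lborel. norm (f x) \<le> norm (M * indicator {a..b} x)"
      using that(2) by (auto intro!: AE_I2 order_trans[OF _ abs_ge_self])
  qed (use that in simp)
  have \<Gamma>_b: "\<bar>\<Gamma> x\<bar> \<le> G * h" for x
  proof -
    have "\<bar>\<Gamma> x\<bar> \<le> (LINT y|lborel. \<bar>indicator {x..x + h} y *\<^sub>R g y\<bar>)"
      unfolding \<Gamma>_def set_lebesgue_integral_def by (rule integral_abs_bound)
    also have "\<dots> \<le> (LINT y|lborel. G * indicator {x..x + h} y)"
      by (rule integral_mono[OF int[of _ G x "x + h"] int[of _ G x "x + h"]])
        (use g G in \<open>auto simp: indicator_def\<close>)
    also have "\<dots> = G * h" using h by simp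
    finally show ?thesis .
  qed
  have [measurable]: "D \<in> borel_measurable borel" unfolding D_def[abs_def] by measurable
  have D_b: "\<bar>D x\<bar> \<le> 2 * B + G * h" for x
    using \<Gamma>_b[of x] p[of x] p[of "x + h"] unfolding D_def by linarith
  have bump_m[measurable]: "bump a b n \<in> borel_measurable borel" for a b n
    by (intro borel_measurable_continuous_onI continuous_bump)
  have bb: "\<bar>bump a b n x\<bar> \<le> 1 * indicator {a..b} x" for a b n x
    using bump_bounds[of a b n x] by (cases "a < x \<and> x < b") (auto simp: indicator_def)
  have int_bump: "integrable lborel (\<lambda>x. f x * bump a b n x)"
    if [measurable]: "f \<in> borel_measurable borel" and "\<And>x. \<bar>f x\<bar> \<le> M" for f M a b n
  proof (rule int[of _ M a b])
    fix x
    have "\<bar>f x\<bar> * \<bar>bump a b n x\<bar> \<le> M * (1 * indicator {a..b} x)"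
      using that(2)[of x] bb[of a b n x] by (intro mult_mono) auto
    then show "\<bar>f x * bump a b n x\<bar> \<le> M * indicator {a..b} x" by (simp add: abs_mult)
  qed measurable
  have D_bump: "(LINT x|lborel. D x * bump a b n x) = 0" for a b n
  proof -
    let ?\<chi> = "bump a b n"
    define \<phi> where "\<phi> y = integral {y - h..y} ?\<chi>" for y
    note tf = test_fun_window[OF h, of a b n, folded \<phi>_def]
    have \<phi>L: "\<phi> y = (LINT x:{y - h..y}|lborel. ?\<chi> x)" for y
      unfolding \<phi>_def
      by (intro set_borel_integral_eq_integral(2)[symmetric] borel_integrable_atLeastAtMost'
          continuous_on_subset[OF continuous_bump]) auto
    have \<phi>L': "\<phi> = (\<lambda>y. LINT x|lborel. (if y - h \<le> x \<and> x \<le> y then ?\<chi> x else 0))"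
      by (auto simp: \<phi>L set_lebesgue_integral_def indicator_def intro!: Bochner_Integration.integral_cong ext)
    have [measurable]: "\<phi> \<in> borel_measurable borel"
    proof -
      have "(\<lambda>y. LINT x|lborel. (if y - h \<le> x \<and> x \<le> y then ?\<chi> x else 0)) \<in> borel_measurable lborel"
        by measurable
      then show ?thesis by (simp add: \<phi>L')
    qed
    have "(LINT x|lborel. p x * (?\<chi> x - ?\<chi> (x - h))) = - (LINT x|lborel. g x * \<phi> x)"
    proof -
      have "(LINT x|lebesgue. p x * deriv \<phi> x) = - (LINT x|lebesgue. g x * \<phi> x)"
        using wd tf(1) unfolding weak_deriv_def \<phi>_def[abs_def] by blast
      moreover have "deriv \<phi> = (\<lambda>y. ?\<chi> y - ?\<chi> (y - h))"
        using tf(2) unfolding \<phi>_def[abs_def] .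
      ultimately show ?thesis by (simp add: integral_completion)
    qed
    moreover have "(LINT x|lborel. p x * (?\<chi> x - ?\<chi> (x - h))) = - (LINT x|lborel. (p (x + h) - p x) * ?\<chi> x)"
    proof -
      have i1: "integrable lborel (\<lambda>x. p x * ?\<chi> x)"
        by (rule int_bump[OF _ p]) measurable
      have i2: "integrable lborel (\<lambda>x. p (x + h) * ?\<chi> x)"
        by (rule int_bump[OF _ p]) measurable
      have i3: "integrable lborel (\<lambda>x. p x * ?\<chi> (x - h))"
        using lborel_integrable_real_affine[OF i2, of 1 "-h"] by (simp add: algebra_simps)
      have "(LINT x|lborel. p x * ?\<chi> (x - h)) = (LINT x|lborel. p (x + h) * ?\<chi> x)"
        by (subst lborel_integral_real_affine[where c=1 and t=h]) (simp_all add: add.commute)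
      then show ?thesis using i1 i2 i3
        by (simp add: right_diff_distrib left_diff_distrib)
    qed
    moreover have "(LINT x|lborel. g x * \<phi> x) = (LINT x|lborel. \<Gamma> x * ?\<chi> x)"
    proof -
      define F where "F = (\<lambda>(y, x). (if y - h \<le> x \<and> x \<le> y then g y * ?\<chi> x else 0))"
      have F: "integrable (lborel \<Otimes>\<^sub>M lborel) F"
      proof (rule Bochner_Integration.integrable_bound)
        show "integrable (lborel \<Otimes>\<^sub>M lborel) (\<lambda>z. G * indicator ({a..b + h} \<times> {a..b}) z :: real)"
          by (intro integrable_mult_right integrable_real_indicator)
            (auto simp: lborel.emeasure_pair_measure_Times ennreal_mult_less_top emeasure_lborel_Icc_eq)
        show "F \<in> borel_measurable (lborel \<Otimes>\<^sub>M lborel)"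
          unfolding F_def by measurable
        have "norm (F (y, x)) \<le> norm (G * indicator ({a..b + h} \<times> {a..b}) (y, x) :: real)" for y x
        proof (cases "y - h \<le> x \<and> x \<le> y \<and> x \<in> {a..b}")
          case True
          then have "(y, x) \<in> {a..b + h} \<times> {a..b}" by auto
          moreover have "\<bar>g y * ?\<chi> x\<bar> \<le> G * 1"
            unfolding abs_mult by (intro mult_mono) (use g[of y] bb[of a b n x] True G in auto)
          ultimately show ?thesis using True G by (simp add: F_def)
        next
          case False
          then have "F (y, x) = 0" using bb[of a b n x] by (auto simp: F_def)
          then show ?thesis by simp
        qed
        then show "AE z in lborel \<Otimes>\<^sub>M lborel. norm (F z) \<le> norm (G * indicator ({a..b + h} \<times> {a..b}) z :: real)"
          by (intro AE_I2) (metis surj_pair)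
      qed
      have "(LINT x|lborel. g x * \<phi> x) = (LINT y|lborel. LINT x|lborel. F (y, x))"
      proof (intro Bochner_Integration.integral_cong refl)
        fix y
        show "g y * \<phi> y = (LINT x|lborel. F (y, x))"
          unfolding \<phi>L'
          by (subst Bochner_Integration.integral_mult_right_zero[symmetric], rule Bochner_Integration.integral_cong)
            (auto simp: F_def)
      qed
      also have "\<dots> = (LINT x|lborel. LINT y|lborel. F (y, x))"
        using lborel_pair.Fubini_integral[of "\<lambda>y x. F (y, x)"] F by (simp add: case_prod_beta)
      also have "\<dots> = (LINT x|lborel. \<Gamma> x * ?\<chi> x)"
      proof (intro Bochner_Integration.integral_cong refl)
        fix x
        show "(LINT y|lborel. F (y, x)) = \<Gamma> x * ?\<chi> x"
          unfolding \<Gamma>_def set_lebesgue_integral_def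
          by (subst Bochner_Integration.integral_mult_left_zero[symmetric], rule Bochner_Integration.integral_cong)
            (auto simp: F_def indicator_def)
      qed
      finally show ?thesis .
    qed
    moreover have "integrable lborel (\<lambda>x. (p (x + h) - p x) * ?\<chi> x)"
    proof (rule int_bump)
      show "\<bar>p (x + h) - p x\<bar> \<le> 2 * B" for x using p[of x] p[of "x + h"] by linarith
    qed measurable
    moreover have "integrable lborel (\<lambda>x. \<Gamma> x * ?\<chi> x)"
      by (rule int_bump[OF _ \<Gamma>_b]) measurable
    ultimately show ?thesis by (simp add: D_def left_diff_distrib)
  qed
  have D_int: "(LINT x|lborel. D x * indicator {a<..<b} x) = 0" for a b
  proof -
    have "(\<lambda>n. LINT x|lborel. D x * bump a b n x) \<longlonglongrightarrow> (LINT x|lborel. D x * indicator {a<..<b} x)"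
    proof (rule integral_dominated_convergence)
      show "integrable lborel (\<lambda>x. (2 * B + G * h) * indicator {a..b} x)"
        by (intro integrable_mult_right integrable_real_indicator) (simp_all add: emeasure_lborel_Icc_eq)
      show "AE x in lborel. (\<lambda>n. D x * bump a b n x) \<longlonglongrightarrow> D x * indicator {a<..<b} x"
        by (intro AE_I2 tendsto_intros bump_tendsto)
      show "AE x in lborel. norm (D x * bump a b n x) \<le> (2 * B + G * h) * indicator {a..b} x" for n
        unfolding real_norm_def abs_mult using bb[of a b n] D_b B G h by (intro AE_I2 mult_mono) auto
    qed auto
    then show ?thesis by (simp add: D_bump LIMSEQ_const_iff)
  qed
  have "AE x in lborel. x \<in> {- real N<..<real N} \<longrightarrow> D x = 0" for N :: nat
  proof -
    have "AE x in lborel. D x * indicator {- real N<..<real N} x = 0"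
    proof (rule AE_zero_if_integral_Ioi_zero)
      show "integrable lborel (\<lambda>x. D x * indicator {- real N<..<real N} x)"
        by (rule int[of _ "2 * B + G * h" "- real N" "real N"])
          (use D_b B G h in \<open>auto simp: indicator_def\<close>)
      fix c
      have "(LINT x:{c<..}|lborel. D x * indicator {- real N<..<real N} x)
        = (LINT x|lborel. D x * indicator {max c (- real N)<..<real N} x)"
        unfolding set_lebesgue_integral_def
        by (rule Bochner_Integration.integral_cong) (auto simp: indicator_def)
      then show "(LINT x:{c<..}|lborel. D x * indicator {- real N<..<real N} x) = 0"
        by (simp add: D_int)
    qed
    then show ?thesis by eventually_elim auto
  qed
  then have "AE x in lborel. \<forall>N::nat. x \<in> {- real N<..<real N} \<longrightarrow> D x = 0"
    unfolding AE_all_countable by blast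
  then show ?thesis
  proof eventually_elim
    case (elim x)
    obtain N where "\<bar>x\<bar> < real N" using reals_Archimedean2 by blast
    then have "x \<in> {- real N<..<real N}" by auto
    then show ?case using elim by (auto simp: D_def \<Gamma>_def)
  qed
qed

lemma W1inf_Lipschitz_representative:
  assumes "W1inf f"
  obtains p L where "p \<in> borel_measurable borel" "AE x in lebesgue. f x = p x"
    "\<And>x. \<bar>p x\<bar> \<le> L" "\<And>h. h \<ge> 0 \<Longrightarrow> AE x in lborel. \<bar>p (x + h) - p x\<bar> \<le> L * h"
proof -
  from assms obtain g0 where g0: "Linf f" "Linf g0" "weak_deriv f g0" by (auto simp: W1inf_def)
  obtain p B where p: "p \<in> borel_measurable borel" "AE x in lebesgue. f x = p x" "\<And>x. \<bar>p x\<bar> \<le> B" "B \<ge> 0"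
    using Linf_borel_representative[OF g0(1)] by blast
  obtain g G where g: "g \<in> borel_measurable borel" "AE x in lebesgue. g0 x = g x" "\<And>x. \<bar>g x\<bar> \<le> G" "G \<ge> 0"
    using Linf_borel_representative[OF g0(2)] by blast
  note [measurable] = p(1) g(1)
  have fm: "f \<in> borel_measurable lebesgue" "g0 \<in> borel_measurable lebesgue" using g0 by (auto simp: Linf_def)
  have "weak_deriv p g" unfolding weak_deriv_def
  proof safe
    fix \<phi> assume \<phi>: "test_fun \<phi>"
    then have "((deriv ^^ 0) \<phi>) differentiable_on UNIV" "((deriv ^^ 1) \<phi>) differentiable_on UNIV"
      unfolding test_fun_def by blast+
    then have "continuous_on UNIV \<phi>" "continuous_on UNIV (deriv \<phi>)"
      by (auto intro: differentiable_imp_continuous_on)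
    then have [measurable]: "\<phi> \<in> borel_measurable borel" "deriv \<phi> \<in> borel_measurable borel"
      by (auto intro: borel_measurable_continuous_onI)
    have m: "\<phi> \<in> borel_measurable lebesgue" "deriv \<phi> \<in> borel_measurable lebesgue"
      "p \<in> borel_measurable lebesgue" "g \<in> borel_measurable lebesgue"
      by (auto intro!: measurable_completion)
    have "(LINT x|lebesgue. f x * deriv \<phi> x) = (LINT x|lebesgue. p x * deriv \<phi> x)"
      by (rule integral_cong_AE) (use m fm p(2) in \<open>auto intro!: borel_measurable_times\<close>)
    moreover have "(LINT x|lebesgue. g0 x * \<phi> x) = (LINT x|lebesgue. g x * \<phi> x)"
      by (rule integral_cong_AE) (use m fm g(2) in \<open>auto intro!: borel_measurable_times\<close>)
    ultimately show "(LINT x|lebesgue. p x * deriv \<phi> x) = - (LINT x|lebesgue. g x * \<phi> x)"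
      using g0(3) \<phi> by (auto simp: weak_deriv_def)
  qed
  note inc = W1inf_increment[OF p(1) g(1) p(3) g(3) this]
  have "AE x in lborel. \<bar>p (x + h) - p x\<bar> \<le> max B G * h" if "h \<ge> 0" for h
  proof (cases "h = 0")
    case False
    then have h: "h > 0" using that by simp
    from inc[OF this] show ?thesis
    proof eventually_elim
      case (elim x)
      have "\<bar>LINT y:{x..x + h}|lborel. g y\<bar> \<le> (LINT y|lborel. \<bar>indicator {x..x + h} y *\<^sub>R g y\<bar>)"
        unfolding set_lebesgue_integral_def by (rule integral_abs_bound)
      also have "\<dots> \<le> (LINT y|lborel. G * indicator {x..x + h} y)"
        by (rule integral_mono', intro integrable_mult_right integrable_real_indicator)
          (use g(3,4) in \<open>auto simp: indicator_def emeasure_lborel_Icc_eq\<close>)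
      also have "\<dots> = G * h" using h by simp
      also have "\<dots> \<le> max B G * h" using h by simp
      finally show ?case by (simp add: elim)
    qed
  qed simp
  then show ?thesis using that[of p "max B G"] p by (metis max.coboundedI1)
qed

subsection \<open>Integrals over half-lines\<close>

lemma exp_neg_integral_atLeast:
  fixes c a :: real
  assumes "c > 0"
  shows "set_integrable lborel {a..} (\<lambda>t. exp (- c * t))"
    and "(LBINT t:{a..}. exp (- c * t)) = exp (- c * a) / c"
proof -
  have I: "((\<lambda>t. exp (- c * t)) has_integral exp (- c * a) / c) {a..}"
    using has_integral_exp_minus_to_infinity[OF assms] .
  then have "(\<lambda>t. exp (- c * t)) absolutely_integrable_on {a..}"
    by (intro nonnegative_absolutely_integrable_1) (auto simp: has_integral_integrable)
  then show *: "set_integrable lborel {a..} (\<lambda>t. exp (- c * t))"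
    by (simp add: set_integrable_def integrable_completion)
  show "(LBINT t:{a..}. exp (- c * t)) = exp (- c * a) / c"
    using set_borel_integral_eq_integral(2)[OF *] integral_unique[OF I] by simp
qed

lemma exp_neg_abs_integrable:
  fixes c :: real
  assumes "c > 0"
  shows "integrable lborel (\<lambda>x. exp (- c * \<bar>x\<bar>))"
proof -
  define F where "F x = indicator {0..} x * exp (- c * x)" for x :: real
  have F: "integrable lborel F"
    using exp_neg_integral_atLeast(1)[OF assms, of 0] by (simp add: set_integrable_def F_def[abs_def])
  then have "integrable lborel (\<lambda>x. F (- x))"
    using lborel_integrable_real_affine[OF F, of "-1" 0] by simp
  with F have "integrable lborel (\<lambda>x. F x + F (- x))" by (intro Bochner_Integration.integrable_add)
  then show ?thesis
    by (rule Bochner_Integration.integrable_bound) (auto simp: F_def indicator_def intro!: AE_I2)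
qed

lemma set_integral_exp_bound:
  fixes f :: "real \<Rightarrow> 'a::{banach, second_countable_topology}"
  assumes c: "c > 0" and m: "set_borel_measurable lborel {a..} f"
    and f: "\<And>t. t \<ge> a \<Longrightarrow> norm (f t) \<le> B * exp (- c * t)"
  shows "set_integrable lborel {a..} f"
    and "norm (LBINT t:{a..}. f t) \<le> B * exp (- c * a) / c"
proof -
  have i: "set_integrable lborel {a..} (\<lambda>t. B * exp (- c * t))"
    by (intro set_integrable_mult_right exp_neg_integral_atLeast c)
  show *: "set_integrable lborel {a..} f"
    by (rule set_integrable_bound[OF i m]) (use f in \<open>auto intro!: AE_I2 order_trans[OF _ abs_ge_self]\<close>)
  have "norm (LBINT t:{a..}. f t) \<le> (LBINT t:{a..}. norm (f t))"
    by (rule set_integral_norm_bound[OF *])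
  also have "\<dots> \<le> (LBINT t:{a..}. B * exp (- c * t))"
    by (rule set_integral_mono[OF set_integrable_norm[OF *] i]) (use f in auto)
  also have "\<dots> = B * exp (- c * a) / c"
    by (simp only: set_integral_mult_right exp_neg_integral_atLeast[OF c] times_divide_eq_right)
  finally show "norm (LBINT t:{a..}. f t) \<le> B * exp (- c * a) / c" .
qed

lemma set_borel_measurable_continuous_atLeast:
  fixes f :: "real \<Rightarrow> 'a::{banach, second_countable_topology}"
  assumes "continuous_on {a..} f"
  shows "set_borel_measurable lborel {a..} f"
  unfolding set_borel_measurable_def
  using borel_measurable_continuous_on_indicator[OF _ assms] by simp

lemma set_integral_atLeast_tendsto:
  fixes f :: "real \<Rightarrow> 'a::euclidean_space"
  assumes "set_integrable lborel {a..} f"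
  shows "((\<lambda>T. integral {a..T} f) \<longlongrightarrow> (LBINT t:{a..}. f t)) at_top"
proof -
  have "((\<lambda>y. LINT x|lborel. indicator {..y} x *\<^sub>R (indicator {a..} x *\<^sub>R f x)) \<longlongrightarrow> (LBINT t:{a..}. f t)) at_top"
    unfolding set_lebesgue_integral_def
    by (rule tendsto_integral_at_top) (use assms in \<open>simp_all add: set_integrable_def\<close>)
  moreover have "(LINT x|lborel. indicator {..y} x *\<^sub>R (indicator {a..} x *\<^sub>R f x)) = integral {a..y} f" for y
  proof -
    have "set_integrable lborel {a..y} f"
      by (rule set_integrable_subset[OF assms]) auto
    from set_borel_integral_eq_integral(2)[OF this] show ?thesis
      unfolding set_lebesgue_integral_def
      by (subst (asm) Bochner_Integration.integral_cong[of lborel lborel _ "\<lambda>x. indicator {..y} x *\<^sub>R (indicator {a..} x *\<^sub>R f x)"])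
        (auto simp: indicator_def)
  qed
  ultimately show ?thesis by simp
qed

lemma set_integral_FTC_atLeast:
  fixes F :: "real \<Rightarrow> 'a::euclidean_space"
  assumes D: "\<And>t. t \<ge> a \<Longrightarrow> (F has_vector_derivative f t) (at t)"
    and f: "set_integrable lborel {a..} f" and L: "(F \<longlongrightarrow> L) at_top"
  shows "(LBINT t:{a..}. f t) = L - F a"
proof -
  have "((\<lambda>T. F T - F a) \<longlongrightarrow> (LBINT t:{a..}. f t)) at_top"
  proof (rule Lim_transform_eventually[OF set_integral_atLeast_tendsto[OF f]])
    show "\<forall>\<^sub>F T in at_top. integral {a..T} f = F T - F a"
      using eventually_ge_at_top[of a]
    proof eventually_elim
      case (elim T)
      then show ?case
        by (intro integral_unique fundamental_theorem_of_calculus)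
          (auto intro: has_vector_derivative_at_within D)
    qed
  qed
  moreover have "((\<lambda>T. F T - F a) \<longlongrightarrow> L - F a) at_top"
    by (intro tendsto_intros L)
  ultimately show ?thesis by (rule tendsto_unique[rotated]) simp
qed

lemma set_integral_shift_atLeast:
  fixes f :: "real \<Rightarrow> 'a::{banach, second_countable_topology}"
  shows "(LBINT t:{a..}. f (s + t)) = (LBINT t:{s + a..}. f t)"
  unfolding set_lebesgue_integral_def
  by (subst (2) lborel_integral_real_affine[where c=1 and t=s])
    (auto simp: indicator_def intro!: Bochner_Integration.integral_cong)

lemma integral_atLeast_split:
  fixes f :: "real \<Rightarrow> 'a::euclidean_space"
  assumes f: "set_integrable lborel {a..} f" and ab: "a \<le> b"
  shows "(LBINT t:{a..}. f t) = integral {a..b} f + (LBINT t:{b..}. f t)"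
proof -
  have i1: "set_integrable lborel {a..b} f" by (rule set_integrable_subset[OF f]) (use ab in auto)
  have i2: "set_integrable lborel {b..} f" by (rule set_integrable_subset[OF f]) (use ab in auto)
  have "((\<lambda>T. integral {a..b} f + integral {b..T} f) \<longlongrightarrow> integral {a..b} f + (LBINT t:{b..}. f t)) at_top"
    by (intro tendsto_intros set_integral_atLeast_tendsto i2)
  moreover have "((\<lambda>T. integral {a..b} f + integral {b..T} f) \<longlongrightarrow> (LBINT t:{a..}. f t)) at_top"
  proof (rule Lim_transform_eventually[OF set_integral_atLeast_tendsto[OF f]])
    show "\<forall>\<^sub>F T in at_top. integral {a..T} f = integral {a..b} f + integral {b..T} f"
      using eventually_ge_at_top[of b]
    proof eventually_elim
      case (elim T)
      have "set_integrable lborel {a..T} f" by (rule set_integrable_subset[OF f]) (use ab in auto)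
      then have "f integrable_on {a..T}" by (rule set_borel_integral_eq_integral)
      from Henstock_Kurzweil_Integration.integral_combine[OF ab elim this] show ?case by simp
    qed
  qed
  ultimately show ?thesis by (rule tendsto_unique[rotated, symmetric]) simp
qed

text \<open>Shifting by half a period turns the increment of the amplitude into a gain of \<open>1 / \<omega>\<close>;
  no differentiability is needed.\<close>

lemma oscillatory_integral_bound:
  fixes f :: "real \<Rightarrow> real"
  assumes \<delta>: "\<delta> > 0" and \<omega>: "\<omega> \<ge> pi" and f: "continuous_on {0..} f"
    and b: "\<And>t. t \<ge> 0 \<Longrightarrow> \<bar>f t\<bar> \<le> A * exp (- \<delta> * t)"
    and l: "\<And>t h. t \<ge> 0 \<Longrightarrow> 0 \<le> h \<Longrightarrow> h \<le> 1 \<Longrightarrow> \<bar>f (t + h) - f t\<bar> \<le> A * h * exp (- \<delta> * t)"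
  shows "\<bar>LBINT t:{0..}. cos (\<omega> * t + \<phi>) * f t\<bar> \<le> A * pi * (1 + 1 / \<delta>) / \<omega>"
proof -
  define \<eta> where "\<eta> = pi / \<omega>"
  define I where "I = (LBINT t:{0..}. cos (\<omega> * t + \<phi>) * f t)"
  have \<omega>0: "\<omega> > 0" using \<omega> pi_gt_zero by linarith
  have \<eta>: "0 \<le> \<eta>" "\<eta> \<le> 1" using \<omega> \<omega>0 by (auto simp: \<eta>_def)
  have A: "A \<ge> 0" using b[of 0] by simp
  have cc: "\<bar>cos y * x\<bar> \<le> \<bar>x\<bar>" for x y :: real
    using mult_right_mono[OF abs_cos_le_one[of y], of "\<bar>x\<bar>"] by (simp add: abs_mult)
  have cf: "continuous_on {0..} (\<lambda>t. cos (\<omega> * t + \<phi>) * f t)"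
    by (intro continuous_intros f)
  have cf': "continuous_on {0..} (\<lambda>t. cos (\<omega> * t + \<phi>) * f (\<eta> + t))"
    by (intro continuous_intros continuous_on_compose2[OF f]) (use \<eta> in auto)
  have i: "set_integrable lborel {0..} (\<lambda>t. cos (\<omega> * t + \<phi>) * f t)"
    by (rule set_integral_exp_bound[OF \<delta> set_borel_measurable_continuous_atLeast[OF cf], of A])
      (use b cc order_trans in \<open>fastforce\<close>)
  have i': "set_integrable lborel {0..} (\<lambda>t. cos (\<omega> * t + \<phi>) * f (\<eta> + t))"
  proof (rule set_integral_exp_bound[OF \<delta> set_borel_measurable_continuous_atLeast[OF cf'], of A])
    fix t :: real assume "t \<ge> 0"
    then have "\<bar>f (\<eta> + t)\<bar> \<le> A * exp (- \<delta> * (\<eta> + t))" using \<eta> by (intro b) auto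
    also have "\<dots> \<le> A * exp (- \<delta> * t)" using A \<eta> \<delta> by (intro mult_left_mono) auto
    finally show "norm (cos (\<omega> * t + \<phi>) * f (\<eta> + t)) \<le> A * exp (- \<delta> * t)"
      using cc order_trans by fastforce
  qed
  have "(LBINT t:{\<eta>..}. cos (\<omega> * t + \<phi>) * f t) = (LBINT t:{0..}. cos (\<omega> * (\<eta> + t) + \<phi>) * f (\<eta> + t))"
    using set_integral_shift_atLeast[of 0 "\<lambda>t. cos (\<omega> * t + \<phi>) * f t" \<eta>] by simp
  also have "\<dots> = (LBINT t:{0..}. - (cos (\<omega> * t + \<phi>) * f (\<eta> + t)))"
  proof -
    have "cos (\<omega> * (\<eta> + t) + \<phi>) = - cos (\<omega> * t + \<phi>)" for t
      using cos_periodic_pi[of "\<omega> * t + \<phi>"] \<omega>0 by (simp add: \<eta>_def algebra_simps)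
    then show ?thesis by simp
  qed
  also have "\<dots> = - (LBINT t:{0..}. cos (\<omega> * t + \<phi>) * f (\<eta> + t))"
    by (simp add: set_lebesgue_integral_def)
  finally have "I = integral {0..\<eta>} (\<lambda>t. cos (\<omega> * t + \<phi>) * f t) - (LBINT t:{0..}. cos (\<omega> * t + \<phi>) * f (\<eta> + t))"
    unfolding I_def by (subst integral_atLeast_split[OF i \<eta>(1)]) simp
  then have "2 * I = integral {0..\<eta>} (\<lambda>t. cos (\<omega> * t + \<phi>) * f t)
      + (LBINT t:{0..}. cos (\<omega> * t + \<phi>) * f t - cos (\<omega> * t + \<phi>) * f (\<eta> + t))"
    using set_integral_diff(2)[OF i i'] by (simp add: I_def)
  moreover have "\<bar>integral {0..\<eta>} (\<lambda>t. cos (\<omega> * t + \<phi>) * f t)\<bar> \<le> A * \<eta>"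
  proof -
    have "norm (integral (cbox 0 \<eta>) (\<lambda>t. cos (\<omega> * t + \<phi>) * f t)) \<le> A * measure lborel (cbox 0 \<eta>)"
    proof (rule integrable_bound[OF A])
      show "(\<lambda>t. cos (\<omega> * t + \<phi>) * f t) integrable_on cbox 0 \<eta>"
        by (intro integrable_continuous continuous_on_subset[OF cf]) auto
      fix t assume "t \<in> cbox 0 \<eta>"
      then have t: "t \<ge> 0" by simp
      have "\<bar>f t\<bar> \<le> A * exp (- \<delta> * t)" using b t by simp
      also have "\<dots> \<le> A * 1" using A t \<delta> by (intro mult_left_mono) auto
      finally show "norm (cos (\<omega> * t + \<phi>) * f t) \<le> A"
        using cc[of "\<omega> * t + \<phi>" "f t"] by simp
    qed
    then show ?thesis using \<eta> by simp
  qed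
  moreover have "norm (LBINT t:{0..}. cos (\<omega> * t + \<phi>) * f t - cos (\<omega> * t + \<phi>) * f (\<eta> + t)) \<le> A * \<eta> * exp (- \<delta> * 0) / \<delta>"
  proof (rule set_integral_exp_bound[OF \<delta>])
    show "set_borel_measurable lborel {0..} (\<lambda>t. cos (\<omega> * t + \<phi>) * f t - cos (\<omega> * t + \<phi>) * f (\<eta> + t))"
      by (intro set_borel_measurable_continuous_atLeast continuous_intros cf cf')
    fix t :: real assume "t \<ge> 0"
    then show "norm (cos (\<omega> * t + \<phi>) * f t - cos (\<omega> * t + \<phi>) * f (\<eta> + t)) \<le> A * \<eta> * exp (- \<delta> * t)"
      using l[of t \<eta>] \<eta> cc[of "\<omega> * t + \<phi>" "f t - f (\<eta> + t)"]
      by (simp add: right_diff_distrib add.commute abs_minus_commute)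
  qed
  ultimately have "\<bar>2 * I\<bar> \<le> A * \<eta> + A * \<eta> / \<delta>"
    by simp
  also have "A * \<eta> + A * \<eta> / \<delta> = A * pi * (1 + 1 / \<delta>) / \<omega>"
    using \<delta> \<omega>0 by (simp add: \<eta>_def field_simps)
  finally show ?thesis unfolding I_def by simp
qed

subsection \<open>Correlations and Laplace transforms\<close>

lemma AE_lborel_shift:
  fixes s :: real
  assumes "AE x in lborel. P x"
  shows "AE x in lborel. P (s + x)"
proof -
  have "AE x in distr lborel borel ((+) s). P x"
    using assms by (subst lborel_distr_plus)
  then show ?thesis
    by (rule AE_distrD[rotated]) simp
qed

definition corr :: "(real \<Rightarrow> real) \<Rightarrow> (real \<Rightarrow> real) \<Rightarrow> real \<Rightarrow> real" where
  "corr f g t = (LBINT x. f x * g (x - t))"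

locale decaying_profile =
  fixes q :: "real \<Rightarrow> real" and \<rho> A :: real
  assumes \<rho>: "\<rho> > 0" and q_borel[measurable]: "q \<in> borel_measurable borel"
    and q_bound: "\<bar>q x\<bar> \<le> A * exp (- \<rho> * \<bar>x\<bar>)"
    and q_Lipschitz: "0 \<le> h \<Longrightarrow> h \<le> 1 \<Longrightarrow> AE x in lborel. \<bar>q (x + h) - q x\<bar> \<le> A * h * exp (- \<rho> * \<bar>x\<bar>)"
begin

definition \<sigma> :: real where "\<sigma> = 3 / 4 * \<rho>"

definition weight_mass :: real where "weight_mass = (LBINT x. exp (- (\<rho> / 4) * \<bar>x\<bar>))"

lemma \<sigma>: "\<sigma> > 0" using \<rho> by (simp add: \<sigma>_def)

lemma A_nonneg: "A \<ge> 0" using q_bound[of 0] by simp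

lemma weight_split: "exp (- \<rho> * \<bar>x\<bar>) * exp (- \<rho> * \<bar>x - t\<bar>) \<le> exp (- \<sigma> * \<bar>t\<bar>) * exp (- (\<rho> / 4) * \<bar>x\<bar>)"
proof -
  have "\<sigma> * \<bar>t\<bar> \<le> \<sigma> * (\<bar>x\<bar> + \<bar>x - t\<bar>)" using \<sigma> by (intro mult_left_mono) auto
  moreover have "\<sigma> * \<bar>x - t\<bar> \<le> \<rho> * \<bar>x - t\<bar>" using \<rho> by (intro mult_right_mono) (auto simp: \<sigma>_def)
  ultimately have "- \<rho> * \<bar>x\<bar> + - \<rho> * \<bar>x - t\<bar> \<le> - \<sigma> * \<bar>t\<bar> + - (\<rho> / 4) * \<bar>x\<bar>"
    by (simp add: \<sigma>_def algebra_simps)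
  then show ?thesis by (simp only: exp_add[symmetric] exp_le_cancel_iff)
qed

lemma weighted_integral_bound:
  assumes [measurable]: "f \<in> borel_measurable borel" "g \<in> borel_measurable borel"
    and f: "\<And>x. \<bar>f x\<bar> \<le> B * exp (- \<rho> * \<bar>x\<bar>)"
    and g: "AE x in lborel. \<bar>g x\<bar> \<le> C * exp (- \<rho> * \<bar>x - t\<bar>)" and C: "C \<ge> 0"
  shows "integrable lborel (\<lambda>x. f x * g x)"
    and "\<bar>LBINT x. f x * g x\<bar> \<le> C * B * weight_mass * exp (- \<sigma> * \<bar>t\<bar>)"
proof -
  have B: "B \<ge> 0" using f[of 0] by simp
  let ?w = "\<lambda>x. C * B * exp (- \<sigma> * \<bar>t\<bar>) * exp (- (\<rho> / 4) * \<bar>x\<bar>)"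
  have w: "integrable lborel ?w"
    by (intro integrable_mult_right exp_neg_abs_integrable) (use \<rho> in simp)
  have le: "AE x in lborel. norm (f x * g x) \<le> ?w x"
    using g
  proof eventually_elim
    case (elim x)
    have "norm (f x * g x) \<le> (B * exp (- \<rho> * \<bar>x\<bar>)) * (C * exp (- \<rho> * \<bar>x - t\<bar>))"
      unfolding real_norm_def abs_mult using elim f[of x] by (intro mult_mono') auto
    also have "\<dots> = C * B * (exp (- \<rho> * \<bar>x\<bar>) * exp (- \<rho> * \<bar>x - t\<bar>))" by simp
    also have "\<dots> \<le> C * B * (exp (- \<sigma> * \<bar>t\<bar>) * exp (- (\<rho> / 4) * \<bar>x\<bar>))"
      using B C by (intro mult_left_mono weight_split) auto
    finally show ?case by (simp add: mult.assoc)
  qed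
  show i: "integrable lborel (\<lambda>x. f x * g x)"
    by (rule Bochner_Integration.integrable_bound[OF w])
      (use le in \<open>auto elim!: eventually_mono intro: order_trans[OF _ abs_ge_self]\<close>)
  have "\<bar>LBINT x. f x * g x\<bar> \<le> (LBINT x. \<bar>f x * g x\<bar>)"
    by (rule integral_abs_bound)
  also have "\<dots> \<le> (LBINT x. ?w x)"
    by (rule integral_mono_AE[OF integrable_abs[OF i] w]) (use le in simp)
  also have "\<dots> = C * B * weight_mass * exp (- \<sigma> * \<bar>t\<bar>)"
    by (simp add: weight_mass_def)
  finally show "\<bar>LBINT x. f x * g x\<bar> \<le> C * B * weight_mass * exp (- \<sigma> * \<bar>t\<bar>)" .
qed

context
  fixes f :: "real \<Rightarrow> real" and B :: real
  assumes f_borel[measurable]: "f \<in> borel_measurable borel"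
    and f_bound: "\<And>x. \<bar>f x\<bar> \<le> B * exp (- \<rho> * \<bar>x\<bar>)"
begin

lemma corr_integrable: "integrable lborel (\<lambda>x. f x * q (x - t))"
  and corr_bound: "\<bar>corr f q t\<bar> \<le> A * B * weight_mass * exp (- \<sigma> * \<bar>t\<bar>)"
  unfolding corr_def
  using weighted_integral_bound[of f "\<lambda>x. q (x - t)" B A t] f_bound q_bound A_nonneg by auto

lemma corr_Lipschitz:
  assumes h: "0 \<le> h" "h \<le> 1"
  shows "\<bar>corr f q (t + h) - corr f q t\<bar> \<le> A * B * weight_mass * h * exp (- \<sigma> * \<bar>t + h\<bar>)"
proof -
  have "AE x in lborel. \<bar>q ((- (t + h) + x) + h) - q (- (t + h) + x)\<bar> \<le> A * h * exp (- \<rho> * \<bar>- (t + h) + x\<bar>)"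
    by (rule AE_lborel_shift[OF q_Lipschitz[OF h]])
  then have "AE x in lborel. \<bar>q (x - (t + h)) - q (x - t)\<bar> \<le> A * h * exp (- \<rho> * \<bar>x - (t + h)\<bar>)"
    by (simp add: algebra_simps abs_minus_commute)
  from weighted_integral_bound(2)[OF _ _ f_bound this] have
    "\<bar>LBINT x. f x * (q (x - (t + h)) - q (x - t))\<bar> \<le> A * h * B * weight_mass * exp (- \<sigma> * \<bar>t + h\<bar>)"
    using A_nonneg h by simp
  also have "(LBINT x. f x * (q (x - (t + h)) - q (x - t))) = corr f q (t + h) - corr f q t"
    unfolding corr_def right_diff_distrib
    by (intro Bochner_Integration.integral_diff corr_integrable)
  finally show ?thesis by (simp add: mult_ac)
qed

lemma continuous_corr: "continuous_on UNIV (corr f q)"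
proof -
  define M where "M = A * B * weight_mass"
  have B: "B \<ge> 0" using f_bound[of 0] by simp
  have "weight_mass \<ge> 0" unfolding weight_mass_def by simp
  then have M: "M \<ge> 0" using A_nonneg B by (simp add: M_def)
  have *: "\<bar>corr f q (t + h) - corr f q t\<bar> \<le> M * h" if "0 \<le> h" "h \<le> 1" for t h
  proof -
    have "\<bar>corr f q (t + h) - corr f q t\<bar> \<le> M * h * exp (- \<sigma> * \<bar>t + h\<bar>)"
      using corr_Lipschitz[OF that] by (simp add: M_def)
    also have "\<dots> \<le> M * h * 1" using M that \<sigma> by (intro mult_left_mono) auto
    finally show ?thesis by simp
  qed
  have **: "\<bar>corr f q s - corr f q t\<bar> \<le> M * \<bar>s - t\<bar>" if "\<bar>s - t\<bar> \<le> 1" for s t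
    using *[of "s - t" t] *[of "t - s" s] that by (cases "s \<ge> t") (auto simp: abs_minus_commute)
  have "isCont (corr f q) t" for t
    unfolding isCont_def
  proof (rule LIM_zero_cancel, rule tendsto_norm_zero_cancel, rule tendsto_sandwich[where f = "\<lambda>_. 0"])
    have "((\<lambda>s. M * \<bar>s - t\<bar>) \<longlongrightarrow> M * \<bar>t - t\<bar>) (at t)" by (intro tendsto_intros)
    then show "((\<lambda>s. M * \<bar>s - t\<bar>) \<longlongrightarrow> 0) (at t)" by simp
    show "\<forall>\<^sub>F s in at t. norm (corr f q s - corr f q t) \<le> M * \<bar>s - t\<bar>"
      using ** by (auto simp: eventually_at dist_real_def intro!: exI[of _ 1])
  qed auto
  then show ?thesis by (simp add: continuous_on_eq_continuous_at)
qed

end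

end

definition laplace :: "(real \<Rightarrow> real) \<Rightarrow> complex \<Rightarrow> complex" where
  "laplace f z = (LBINT t:{0..}. exp (- z * of_real t) * of_real (f t))"

lemma
  fixes f :: "real \<Rightarrow> real"
  assumes f: "continuous_on {0..} f" and b: "\<And>t. t \<ge> 0 \<Longrightarrow> \<bar>f t\<bar> \<le> B * exp (- s * t)"
    and z: "Re z > - s" and a: "a \<ge> 0"
  shows laplace_integrable: "set_integrable lborel {a..} (\<lambda>t. exp (- z * of_real t) * of_real (f t))"
    and laplace_tail: "norm (LBINT t:{a..}. exp (- z * of_real t) * of_real (f t)) \<le> B * exp (- (Re z + s) * a) / (Re z + s)"
proof -
  have c: "Re z + s > 0" using z by simp
  have m: "set_borel_measurable lborel {a..} (\<lambda>t. exp (- z * of_real t) * of_real (f t))"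
    by (intro set_borel_measurable_continuous_atLeast continuous_intros continuous_on_subset[OF f])
      (use a in auto)
  have n: "norm (exp (- z * of_real t) * of_real (f t)) \<le> B * exp (- (Re z + s) * t)" if "t \<ge> a" for t
  proof -
    have "norm (exp (- z * of_real t) * of_real (f t)) = exp (- Re z * t) * \<bar>f t\<bar>"
      by (simp add: norm_mult)
    also have "\<dots> \<le> exp (- Re z * t) * (B * exp (- s * t))"
      using b[of t] that a by (intro mult_left_mono) auto
    also have "\<dots> = B * exp (- (Re z + s) * t)"
      by (simp add: algebra_simps exp_add[symmetric])
    finally show ?thesis .
  qed
  show "set_integrable lborel {a..} (\<lambda>t. exp (- z * of_real t) * of_real (f t))"
    "norm (LBINT t:{a..}. exp (- z * of_real t) * of_real (f t)) \<le> B * exp (- (Re z + s) * a) / (Re z + s)"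
    using set_integral_exp_bound[OF c m, of B] n by auto
qed

lemma laplace_holomorphic:
  fixes f :: "real \<Rightarrow> real"
  assumes f: "continuous_on {0..} f" and b: "\<And>t. t \<ge> 0 \<Longrightarrow> \<bar>f t\<bar> \<le> B * exp (- s * t)"
  shows "laplace f holomorphic_on {z. Re z > - s}"
proof -
  define F where "F n z = integral {0..real n} (\<lambda>t. exp (- z * of_real t) * of_real (f t))" for n and z :: complex
  have B: "B \<ge> 0" using b[of 0] by simp
  show ?thesis
  proof (rule holomorphic_uniform_sequence)
    show "open {z. Re z > - s}" by (rule open_halfspace_Re_gt)
    show "F n holomorphic_on {z. Re z > - s}" for n
    proof -
      have c: "continuous_on ({z. Re z > - s} \<times> cbox 0 (real n)) (\<lambda>(z, t). - of_real t * exp (- z * of_real t) * of_real (f t))"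
        unfolding split_beta
        by (intro continuous_intros continuous_on_compose2[OF f]) auto
      have "(\<lambda>z. integral (cbox 0 (real n)) (\<lambda>t. exp (- z * of_real t) * of_real (f t))) holomorphic_on {z. Re z > - s}"
      proof (rule leibniz_rule_holomorphic[OF _ _ c])
        show "((\<lambda>z. exp (- z * of_real t) * of_real (f t)) has_field_derivative
            - of_real t * exp (- z * of_real t) * of_real (f t)) (at z within {z. Re z > - s})" for z and t :: real
          by (auto intro!: derivative_eq_intros)
        show "(\<lambda>t. exp (- z * of_real t) * of_real (f t)) integrable_on cbox 0 (real n)" for z :: complex
          by (intro integrable_continuous continuous_intros continuous_on_subset[OF f]) auto
      qed (rule convex_halfspace_Re_gt)
      then show ?thesis by (simp add: F_def[abs_def])
    qed
    fix z assume "z \<in> {z. Re z > - s}"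
    then have z: "Re z > - s" by simp
    define d where "d = (Re z + s) / 2"
    have d: "d > 0" using z by (simp add: d_def)
    have re: "Re w + s \<ge> d" if "w \<in> cball z d" for w
    proof -
      have "\<bar>Re (z - w)\<bar> \<le> d" using that abs_Re_le_cmod[of "z - w"] by (simp add: dist_norm)
      then have "Re z - Re w \<le> d" by (simp add: abs_le_iff)
      moreover have "Re z + s = 2 * d" by (simp add: d_def)
      ultimately show ?thesis by linarith
    qed
    have "uniform_limit (cball z d) F (laplace f) sequentially"
    proof (rule uniform_limitI)
      fix e :: real assume e: "e > 0"
      have "(\<lambda>n. B / d * exp (- d * real n)) \<longlonglongrightarrow> B / d * 0"
        by (intro tendsto_intros filterlim_compose[OF exp_at_bot]
            filterlim_tendsto_neg_mult_at_bot[OF tendsto_const _ filterlim_real_sequentially]) (use d in auto)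
      then have "\<forall>\<^sub>F n in sequentially. B / d * exp (- d * real n) < e"
        using e by (intro order_tendstoD) auto
      then show "\<forall>\<^sub>F n in sequentially. \<forall>w\<in>cball z d. dist (F n w) (laplace f w) < e"
      proof eventually_elim
        case (elim n)
        show ?case
        proof
          fix w assume w: "w \<in> cball z d"
          then have w': "Re w > - s" using re[OF w] d by linarith
          have "laplace f w = F n w + (LBINT t:{real n..}. exp (- w * of_real t) * of_real (f t))"
            unfolding laplace_def F_def
            by (rule integral_atLeast_split[OF laplace_integrable[OF f b w']]) auto
          then have "dist (F n w) (laplace f w) = norm (LBINT t:{real n..}. exp (- w * of_real t) * of_real (f t))"
            by (simp add: dist_norm norm_minus_commute)
          also have "\<dots> \<le> B * exp (- (Re w + s) * real n) / (Re w + s)"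
            by (rule laplace_tail[OF f b w']) auto
          also have "\<dots> \<le> B * exp (- d * real n) / d"
          proof (intro frac_le mult_left_mono)
            have "d * real n \<le> (Re w + s) * real n" using re[OF w] by (intro mult_right_mono) auto
            then show "exp (- (Re w + s) * real n) \<le> exp (- d * real n)"
              by (simp add: algebra_simps)
          qed (use re[OF w] d B in auto)
          also have "\<dots> < e" using elim by simp
          finally show "dist (F n w) (laplace f w) < e" .
        qed
      qed
    qed
    then show "\<exists>d. 0 < d \<and> cball z d \<subseteq> {z. Re z > - s} \<and> uniform_limit (cball z d) F (laplace f) sequentially"
      using d re by (intro exI[of _ d]) force
  qed
qed

lemma laplace_of_real:
  fixes x :: real
  shows "laplace f (of_real x) = of_real (LBINT t:{0..}. exp (- x * t) * f t)"
proof -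
  have "laplace f (of_real x) = (LBINT t:{0..}. complex_of_real (exp (- x * t) * f t))"
    unfolding laplace_def by (simp add: exp_of_real[symmetric])
  then show ?thesis by (simp only: set_integral_complex_of_real)
qed

subsection \<open>The oscillating kernel\<close>

lemma abs_exp_minus_one_le: "\<bar>exp y - 1\<bar> \<le> \<bar>y\<bar> * exp \<bar>y\<bar>" for y :: real
proof (cases "y \<ge> 0")
  case True
  have "exp y * (1 - y) \<le> exp y * exp (- y)"
    using exp_ge_add_one_self[of "- y"] by (intro mult_left_mono) auto
  then show ?thesis using True by (simp add: exp_minus algebra_simps)
next
  case False
  have "1 - exp y \<le> - y" using exp_ge_add_one_self[of y] by linarith
  also have "\<dots> \<le> - y * exp (- y)" using False by simp
  finally show ?thesis using False by simp
qed


locale oscillating_kernel =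
  fixes C :: "real \<Rightarrow> real" and \<sigma> M :: real
  assumes \<sigma>: "\<sigma> > 0" and C_cont: "continuous_on UNIV C"
    and C_bound: "t \<ge> 0 \<Longrightarrow> \<bar>C t\<bar> \<le> M * exp (- \<sigma> * t)"
    and C_Lipschitz: "t \<ge> 0 \<Longrightarrow> 0 \<le> h \<Longrightarrow> h \<le> 1 \<Longrightarrow> \<bar>C (t + h) - C t\<bar> \<le> M * h * exp (- \<sigma> * t)"
begin

text \<open>The amplitude \<open>C\<close> is the autocorrelation of the profile; \<open>k \<omega>\<close> is the memory kernel
  of the Volterra equation satisfied by \<open>a\<close>, so that its Laplace transform is \<open>K\<^sub>\<omega>\<close>.\<close>

definition k :: "real \<Rightarrow> real \<Rightarrow> real" where "k \<omega> t = cos (\<omega> * t) * C t"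

definition osc_const :: real where "osc_const = M * (1 + \<sigma> / 2) * exp (\<sigma> / 2) * pi * (1 + 2 / \<sigma>)"

lemma M_nonneg: "M \<ge> 0" using C_bound[of 0] by simp

lemma osc_const_nonneg: "osc_const \<ge> 0" using M_nonneg \<sigma> by (simp add: osc_const_def)

lemma k_cont: "continuous_on S (k \<omega>)"
  unfolding k_def[abs_def] by (intro continuous_intros continuous_on_subset[OF C_cont]) auto

lemma k_bound: "t \<ge> 0 \<Longrightarrow> \<bar>k \<omega> t\<bar> \<le> M * exp (- \<sigma> * t)"
  using mult_right_mono[OF abs_cos_le_one[of "\<omega> * t"], of "\<bar>C t\<bar>"] C_bound[of t]
  by (simp add: k_def abs_mult)

lemma exp_weighted_tail_bound:
  assumes s: "s \<ge> 0" and \<theta>: "\<bar>\<theta>\<bar> \<le> \<sigma> / 2" and \<omega>: "\<omega> \<ge> pi"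
  shows "\<bar>LBINT t:{0..}. exp (\<theta> * t) * k \<omega> (s + t)\<bar> \<le> osc_const / \<omega> * exp (- \<sigma> * s)"
proof -
  define f where "f t = C (s + t) * exp (\<theta> * t)" for t
  define A where "A = M * (1 + \<sigma> / 2) * exp (\<sigma> / 2) * exp (- \<sigma> * s)"
  have weight: "exp (- \<sigma> * (s + t)) * exp (\<theta> * t) \<le> exp (- \<sigma> * s) * exp (- (\<sigma> / 2) * t)" if "t \<ge> 0" for t
  proof -
    have "\<theta> * t \<le> \<sigma> / 2 * t" using \<theta> that by (intro mult_right_mono) auto
    then have "- \<sigma> * (s + t) + \<theta> * t \<le> - \<sigma> * s + - (\<sigma> / 2) * t" by (simp add: algebra_simps)
    then show ?thesis by (simp only: exp_add[symmetric] exp_le_cancel_iff)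
  qed
  have "\<bar>LBINT t:{0..}. cos (\<omega> * t + \<omega> * s) * f t\<bar> \<le> A * pi * (1 + 1 / (\<sigma> / 2)) / \<omega>"
  proof (rule oscillatory_integral_bound)
    show "continuous_on {0..} f"
      unfolding f_def by (intro continuous_intros continuous_on_compose2[OF C_cont]) auto
    fix t :: real assume t: "t \<ge> 0"
    have Cb: "\<bar>C (s + t)\<bar> * exp (\<theta> * t) \<le> M * (exp (- \<sigma> * s) * exp (- (\<sigma> / 2) * t))"
    proof -
      have "\<bar>C (s + t)\<bar> * exp (\<theta> * t) \<le> M * exp (- \<sigma> * (s + t)) * exp (\<theta> * t)"
        using C_bound[of "s + t"] s t by (intro mult_right_mono) auto
      also have "\<dots> \<le> M * (exp (- \<sigma> * s) * exp (- (\<sigma> / 2) * t))"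
        using weight[OF t] M_nonneg by (simp only: mult.assoc mult_left_mono)
      finally show ?thesis .
    qed
    have "1 * 1 \<le> (1 + \<sigma> / 2) * exp (\<sigma> / 2)" using \<sigma> by (intro mult_mono) auto
    then have "M * 1 \<le> M * ((1 + \<sigma> / 2) * exp (\<sigma> / 2))" using M_nonneg by (intro mult_left_mono) auto
    then have "M * (exp (- \<sigma> * s) * exp (- (\<sigma> / 2) * t)) \<le> M * ((1 + \<sigma> / 2) * exp (\<sigma> / 2)) * (exp (- \<sigma> * s) * exp (- (\<sigma> / 2) * t))"
      by (intro mult_right_mono) auto
    with Cb show "\<bar>f t\<bar> \<le> A * exp (- (\<sigma> / 2) * t)"
      by (simp add: f_def A_def abs_mult mult_ac)
    fix h :: real assume h: "0 \<le> h" "h \<le> 1"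
    have th: "\<bar>\<theta> * h\<bar> \<le> \<sigma> / 2 * h" using mult_right_mono[OF \<theta> h(1)] h by (simp add: abs_mult)
    also have "\<dots> \<le> \<sigma> / 2" using h \<sigma> by simp
    finally have th1: "\<bar>\<theta> * h\<bar> \<le> \<sigma> / 2" .
    have E: "exp (\<theta> * h) \<le> exp (\<sigma> / 2)" using th1 by simp
    have E1: "\<bar>exp (\<theta> * h) - 1\<bar> \<le> \<sigma> / 2 * h * exp (\<sigma> / 2)"
    proof -
      have "\<bar>exp (\<theta> * h) - 1\<bar> \<le> \<bar>\<theta> * h\<bar> * exp \<bar>\<theta> * h\<bar>"
        by (rule abs_exp_minus_one_le)
      also have "\<dots> \<le> \<sigma> / 2 * h * exp (\<sigma> / 2)" using th th1 \<sigma> h by (intro mult_mono) auto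
      finally show ?thesis .
    qed
    have W: "exp (\<theta> * (t + h)) = exp (\<theta> * t) * exp (\<theta> * h)" by (simp add: exp_add[symmetric] algebra_simps)
    let ?w = "exp (- \<sigma> * s) * exp (- (\<sigma> / 2) * t)"
    have D1: "\<bar>C (s + t + h) - C (s + t)\<bar> * exp (\<theta> * t) \<le> M * h * ?w"
    proof -
      have "\<bar>C (s + t + h) - C (s + t)\<bar> * exp (\<theta> * t) \<le> M * h * exp (- \<sigma> * (s + t)) * exp (\<theta> * t)"
        using C_Lipschitz[of "s + t" h] s t h by (intro mult_right_mono) auto
      also have "\<dots> = M * h * (exp (- \<sigma> * (s + t)) * exp (\<theta> * t))" by simp
      also have "\<dots> \<le> M * h * ?w" using weight[OF t] M_nonneg h by (intro mult_left_mono) auto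
      finally show ?thesis .
    qed
    have "f (t + h) - f t = (C (s + t + h) - C (s + t)) * exp (\<theta> * t) * exp (\<theta> * h)
        + C (s + t) * exp (\<theta> * t) * (exp (\<theta> * h) - 1)"
      unfolding f_def W by (simp add: algebra_simps)
    then have "\<bar>f (t + h) - f t\<bar> \<le> \<bar>C (s + t + h) - C (s + t)\<bar> * exp (\<theta> * t) * exp (\<theta> * h)
        + \<bar>C (s + t)\<bar> * exp (\<theta> * t) * \<bar>exp (\<theta> * h) - 1\<bar>"
      by (simp add: abs_mult order_trans[OF abs_triangle_ineq])
    also have "\<dots> \<le> (M * h * ?w) * exp (\<sigma> / 2) + (M * ?w) * (\<sigma> / 2 * h * exp (\<sigma> / 2))"
      by (intro add_mono mult_mono[OF D1 E] mult_mono[OF Cb E1]) (use Cb M_nonneg h in auto)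
    also have "\<dots> = A * h * exp (- (\<sigma> / 2) * t)"
      by (simp add: A_def algebra_simps)
    finally show "\<bar>f (t + h) - f t\<bar> \<le> A * h * exp (- (\<sigma> / 2) * t)" .
  qed (use \<sigma> \<omega> in auto)
  moreover have "cos (\<omega> * t + \<omega> * s) * f t = exp (\<theta> * t) * k \<omega> (s + t)" for t
    by (simp add: f_def k_def algebra_simps)
  ultimately show ?thesis by (simp add: A_def osc_const_def mult_ac)
qed

lemma decay_rate_exists:
  assumes \<omega>: "\<omega> \<ge> pi" "osc_const / \<omega> \<le> \<sigma> / 2"
  obtains \<theta> where "\<theta> = (LBINT t:{0..}. exp (\<theta> * t) * k \<omega> t)" "\<bar>\<theta>\<bar> \<le> osc_const / \<omega>"
proof -
  define L where "L x = (LBINT t:{0..}. exp (- x * t) * k \<omega> t)" for x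
  have L_bound: "\<bar>L x\<bar> \<le> osc_const / \<omega>" if "\<bar>x\<bar> \<le> \<sigma> / 2" for x
    using exp_weighted_tail_bound[of 0 "- x" \<omega>] that \<omega> by (simp add: L_def)
  have "continuous_on {- (\<sigma> / 2)..\<sigma> / 2} (\<lambda>x. x + Re (laplace (k \<omega>) (of_real x)))"
    by (intro continuous_intros continuous_on_compose2[OF holomorphic_on_imp_continuous_on[OF laplace_holomorphic[OF k_cont k_bound]]])
      (use \<sigma> in auto)
  then have "continuous_on {- (\<sigma> / 2)..\<sigma> / 2} (\<lambda>x. x + L x)"
    by (simp add: laplace_of_real L_def[abs_def])
  moreover have "- (\<sigma> / 2) + L (- (\<sigma> / 2)) \<le> 0" "0 \<le> \<sigma> / 2 + L (\<sigma> / 2)"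
    using L_bound[of "\<sigma> / 2"] L_bound[of "- (\<sigma> / 2)"] \<omega>(2) \<sigma> by linarith+
  ultimately obtain x where x: "- (\<sigma> / 2) \<le> x" "x \<le> \<sigma> / 2" "x + L x = 0"
    using IVT'[of "\<lambda>x. x + L x" "- (\<sigma> / 2)" 0 "\<sigma> / 2"] \<sigma> by auto
  then have "- x = L x" by simp
  moreover from this have "\<bar>- x\<bar> \<le> osc_const / \<omega>" using L_bound[of x] x by (metis abs_le_iff minus_le_iff)
  ultimately show ?thesis using that[of "- x"] unfolding L_def by blast
qed

text \<open>With \<open>-\<theta>\<close> the zero of \<open>z + K z\<close>, the function \<open>m s = \<integral>\<^sub>s\<^sup>\<infinity> k t exp (\<theta> (t - s)) dt\<close> is the inverse
  Laplace transform of \<open>- (K z - K (-\<theta>)) / (z + \<theta>)\<close>.\<close>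

lemma memory_function_exists:
  assumes \<omega>: "\<omega> \<ge> pi" and \<theta>: "\<theta> = (LBINT t:{0..}. exp (\<theta> * t) * k \<omega> t)" "\<bar>\<theta>\<bar> \<le> \<sigma> / 2"
  obtains m where "\<And>t. (m has_real_derivative (- k \<omega> t - \<theta> * m t)) (at t)" "m 0 = \<theta>"
    "\<And>t. t \<ge> 0 \<Longrightarrow> \<bar>m t\<bar> \<le> osc_const / \<omega> * exp (- \<sigma> * t)"
proof -
  define w where "w t = exp (\<theta> * t) * k \<omega> t" for t
  have wc: "continuous_on S w" for S
    unfolding w_def[abs_def] by (intro continuous_intros k_cont)
  obtain W where W: "\<And>x. (W has_real_derivative w x) (at x)"
    using einterval_antiderivative[of "-\<infinity>" \<infinity> w] wc[of UNIV]
    by (auto simp: continuous_on_eq_continuous_at has_real_derivative_iff_has_vector_derivative)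
  define m where "m s = exp (- \<theta> * s) * (W 0 + \<theta> - W s)" for s
  have wi: "set_integrable lborel {s..} w" if "s \<ge> 0" for s
  proof (rule set_integral_exp_bound(1))
    show "\<sigma> - \<theta> > 0" using \<theta> \<sigma> by linarith
    show "set_borel_measurable lborel {s..} w" by (intro set_borel_measurable_continuous_atLeast wc)
    fix t assume "s \<le> t"
    then have "\<bar>w t\<bar> \<le> exp (\<theta> * t) * (M * exp (- \<sigma> * t))"
      unfolding w_def abs_mult using k_bound[of t \<omega>] that by (intro mult_mono) auto
    also have "\<dots> = M * exp (- (\<sigma> - \<theta>) * t)"
      by (simp add: exp_add[symmetric] algebra_simps)
    finally show "norm (w t) \<le> M * exp (- (\<sigma> - \<theta>) * t)" by simp
  qed
  have I: "integral {0..T} w = W T - W 0" if "T \<ge> 0" for T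
    using W that by (intro integral_unique fundamental_theorem_of_calculus)
      (auto simp: has_real_derivative_iff_has_vector_derivative[symmetric] intro: DERIV_subset)
  have "((\<lambda>T. integral {0..T} w) \<longlongrightarrow> \<theta>) at_top"
    using set_integral_atLeast_tendsto[OF wi[of 0]] \<theta>(1) by (simp add: w_def[abs_def])
  then have "((\<lambda>T. W 0 + integral {0..T} w) \<longlongrightarrow> W 0 + \<theta>) at_top"
    by (intro tendsto_intros)
  then have W_lim: "(W \<longlongrightarrow> W 0 + \<theta>) at_top"
    by (rule Lim_transform_eventually) (auto simp: I intro!: eventually_mono[OF eventually_ge_at_top[of 0]])
  have m_eq: "m s = (LBINT t:{0..}. exp (\<theta> * t) * k \<omega> (s + t))" if "s \<ge> 0" for s
  proof -
    have "W 0 + \<theta> - W s = (LBINT t:{s..}. w t)"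
      by (rule set_integral_FTC_atLeast[symmetric, OF _ wi[OF that] W_lim])
        (use W in \<open>simp add: has_real_derivative_iff_has_vector_derivative\<close>)
    also have "\<dots> = (LBINT t:{0..}. w (s + t))"
      using set_integral_shift_atLeast[of 0 w s] by simp
    also have "\<dots> = (LBINT t:{0..}. exp (\<theta> * s) * (exp (\<theta> * t) * k \<omega> (s + t)))"
      by (simp add: w_def distrib_left exp_add mult_ac)
    also have "\<dots> = exp (\<theta> * s) * (LBINT t:{0..}. exp (\<theta> * t) * k \<omega> (s + t))"
      by simp
    finally show ?thesis by (simp add: m_def exp_minus)
  qed
  have "(m has_real_derivative (- k \<omega> t - \<theta> * m t)) (at t)" for t
    unfolding m_def
    by (rule derivative_eq_intros W refl)+ (simp add: w_def exp_minus field_simps)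
  moreover have "m 0 = \<theta>" by (simp add: m_def)
  moreover have "\<bar>m t\<bar> \<le> osc_const / \<omega> * exp (- \<sigma> * t)" if "t \<ge> 0" for t
    using exp_weighted_tail_bound[OF that \<theta>(2) \<omega>] m_eq[OF that] by simp
  ultimately show ?thesis using that by blast
qed

lemma laplace_factorization:
  assumes m: "\<And>t. (m has_real_derivative (- k \<omega> t - \<theta> * m t)) (at t)" "m 0 = \<theta>"
    and b: "\<And>t. t \<ge> 0 \<Longrightarrow> \<bar>m t\<bar> \<le> B * exp (- \<sigma> * t)" and z: "Re z > - \<sigma>"
  shows "z + laplace (k \<omega>) z = (z + of_real \<theta>) * (1 - laplace m z)"
proof -
  define F where "F t = exp (- z * of_real t) * of_real (m t)" for t
  have mc: "continuous_on S m" for S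
    using m(1) by (meson DERIV_continuous continuous_at_imp_continuous_at_within continuous_on_eq_continuous_within)
  let ?e = "\<lambda>f t. exp (- z * of_real t) * of_real (f t)"
  have im: "set_integrable lborel {0..} (?e m)"
    by (rule laplace_integrable[OF mc b z]) auto
  have ik: "set_integrable lborel {0..} (?e (k \<omega>))"
    by (rule laplace_integrable[OF k_cont k_bound z]) auto
  define F' where "F' t = - ?e (k \<omega>) t - (z + of_real \<theta>) * ?e m t" for t
  have iF': "set_integrable lborel {0..} F'"
    unfolding F'_def
    using set_integral_diff(1)[OF set_integrable_mult_right[OF ik, of "- 1"] set_integrable_mult_right[OF im, of "z + of_real \<theta>"]]
    by simp
  have "(LBINT t:{0..}. F' t) = 0 - F 0"
  proof (rule set_integral_FTC_atLeast[OF _ iF'])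
    fix t
    have "((\<lambda>t. complex_of_real (m t)) has_vector_derivative of_real (- k \<omega> t - \<theta> * m t)) (at t)"
      by (rule has_vector_derivative_of_real[OF m(1)])
    moreover have "((\<lambda>t. exp (- z * of_real t)) has_vector_derivative (- z * exp (- z * of_real t))) (at t)"
      by (rule has_vector_derivative_real_field) (auto intro!: derivative_eq_intros)
    ultimately have "(F has_vector_derivative (exp (- z * of_real t) * of_real (- k \<omega> t - \<theta> * m t)
        + (- z * exp (- z * of_real t)) * of_real (m t))) (at t)"
      unfolding F_def by (rule has_vector_derivative_mult[rotated])
    then show "(F has_vector_derivative F' t) (at t)"
      by (rule has_vector_derivative_eq_rhs) (simp add: F'_def algebra_simps)
  next
    have "((\<lambda>t. B * exp (- (Re z + \<sigma>) * t)) \<longlongrightarrow> B * 0) at_top"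
      by (intro tendsto_intros filterlim_compose[OF exp_at_bot]
          filterlim_tendsto_neg_mult_at_bot[OF tendsto_const _ filterlim_ident]) (use z in auto)
    then have lim: "((\<lambda>t. B * exp (- (Re z + \<sigma>) * t)) \<longlongrightarrow> 0) at_top" by simp
    have "\<forall>\<^sub>F t in at_top. norm (F t) \<le> B * exp (- (Re z + \<sigma>) * t)"
      using eventually_ge_at_top[of 0]
    proof eventually_elim
      case (elim t)
      have "norm (F t) = exp (- Re z * t) * \<bar>m t\<bar>" by (simp add: F_def norm_mult)
      also have "\<dots> \<le> exp (- Re z * t) * (B * exp (- \<sigma> * t))"
        using b[OF elim] by (intro mult_left_mono) auto
      finally show ?case by (simp add: algebra_simps exp_add[symmetric])
    qed
    then show "(F \<longlongrightarrow> 0) at_top" by (rule Lim_null_comparison[OF _ lim])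
  qed
  moreover have "(LBINT t:{0..}. F' t) = - laplace (k \<omega>) z - (z + of_real \<theta>) * laplace m z"
  proof -
    have "(LBINT t:{0..}. F' t) = (LBINT t:{0..}. - ?e (k \<omega>) t) - (LBINT t:{0..}. (z + of_real \<theta>) * ?e m t)"
      unfolding F'_def by (rule set_integral_diff(2)) (use set_integrable_mult_right[OF ik, of "- 1"] set_integrable_mult_right[OF im, of "z + of_real \<theta>"] in auto)
    then show ?thesis by (simp add: laplace_def set_lebesgue_integral_def)
  qed
  ultimately have "laplace (k \<omega>) z + (z + of_real \<theta>) * laplace m z = of_real \<theta>"
    by (simp add: F_def m(2) algebra_simps)
  then show ?thesis by (simp add: algebra_simps)
qed

end

subsection \<open>Volterra equations\<close>

lemma convolution_has_derivative:
  fixes m m' a :: "real \<Rightarrow> real"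
  assumes m: "\<And>t. (m has_real_derivative m' t) (at t)" and m': "continuous_on UNIV m'"
    and a: "continuous_on {0..} a" and t: "t \<ge> 0"
  shows "((\<lambda>t. integral {0..t} (\<lambda>s. m (t - s) * a s)) has_real_derivative
      m 0 * a t + integral {0..t} (\<lambda>s. m' (t - s) * a s)) (at t within {0..})"
proof -
  define f where "f x y = integral {0..y} (\<lambda>s. m (x - s) * a s)" for x y
  have mc: "continuous_on S m" for S
    using m by (meson DERIV_continuous continuous_at_imp_continuous_at_within continuous_on_eq_continuous_within)
  have dx: "((\<lambda>x. f x t) has_real_derivative integral {0..t} (\<lambda>s. m' (t - s) * a s)) (at t)"
  proof -
    have "((\<lambda>x. integral (cbox 0 t) (\<lambda>s. m (x - s) * a s)) has_real_derivative
        integral (cbox 0 t) (\<lambda>s. m' (t - s) * a s)) (at t within UNIV)"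
    proof (rule leibniz_rule_field_derivative[where U=UNIV and fx="\<lambda>x s. m' (x - s) * a s"])
      show "((\<lambda>x. m (x - s) * a s) has_real_derivative m' (x - s) * a s) (at x within UNIV)" for x s
        by (rule derivative_eq_intros DERIV_chain2[OF m] refl)+ simp
      show "(\<lambda>s. m (x - s) * a s) integrable_on cbox 0 t" for x
        by (intro integrable_continuous continuous_intros continuous_on_compose2[OF mc[of UNIV]] continuous_on_subset[OF a]) auto
      show "continuous_on (UNIV \<times> cbox 0 t) (\<lambda>(x, s). m' (x - s) * a s)"
        unfolding split_beta
        by (intro continuous_intros continuous_on_compose2[OF m'] continuous_on_compose2[OF a]) auto
    qed auto
    then show ?thesis by (simp add: f_def)
  qed
  have dy: "(f x has_real_derivative m (x - y) * a y) (at y within {0..})" if "y \<in> {0..}" for x y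
  proof -
    have "((\<lambda>y. integral {0..y} (\<lambda>s. m (x - s) * a s)) has_real_derivative m (x - y) * a y) (at y within {0..y + 1})"
      by (rule integral_has_real_derivative)
        (use that in \<open>auto intro!: continuous_intros continuous_on_compose2[OF mc[of UNIV]] continuous_on_subset[OF a]\<close>)
    moreover have "at y within {0..y + 1} = at y within {0..}"
      by (rule at_within_nhd[of _ "{..<y + 1}"]) auto
    ultimately show ?thesis by (simp add: f_def[abs_def])
  qed
  have "((\<lambda>(x, y). f x y) has_derivative
      (\<lambda>(tx, ty). integral {0..t} (\<lambda>s. m' (t - s) * a s) * tx + blinfun_mult_right (m (t - t) * a t) ty))
      (at (t, t) within UNIV \<times> {0..})"
  proof (rule has_derivative_partialsI[where fy = "\<lambda>x y. blinfun_mult_right (m (x - y) * a y)"])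
    show "((\<lambda>x. f x t) has_derivative (*) (integral {0..t} (\<lambda>s. m' (t - s) * a s))) (at t within UNIV)"
      using dx by (simp add: has_field_derivative_def)
    show "(f x has_derivative blinfun_apply (blinfun_mult_right (m (x - y) * a y))) (at y within {0..})"
      if "y \<in> {0..}" for x y
      using dy[OF that, of x] by (simp add: has_field_derivative_def)
    have "continuous_on (UNIV \<times> {0..}) (\<lambda>(x, y). blinfun_mult_right (m (x - y) * a y))"
      unfolding split_beta
      by (intro continuous_intros continuous_on_compose2[OF mc[of UNIV]] continuous_on_compose2[OF a]) auto
    then show "continuous (at (t, t) within UNIV \<times> {0..}) (\<lambda>(x, y). blinfun_mult_right (m (x - y) * a y))"
      using t by (simp add: continuous_on_eq_continuous_within)
  qed (use t in auto)
  then have "((\<lambda>(x, y). f x y) has_derivative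
      (\<lambda>(tx, ty). integral {0..t} (\<lambda>s. m' (t - s) * a s) * tx + m 0 * a t * ty))
      (at (t, t) within UNIV \<times> {0..})"
    by (simp add: case_prod_beta)
  then have D2: "((\<lambda>(x, y). f x y) has_derivative
      (\<lambda>(tx, ty). integral {0..t} (\<lambda>s. m' (t - s) * a s) * tx + m 0 * a t * ty))
      (at (t, t) within (\<lambda>t. (t, t)) ` {0..})"
    by (rule has_derivative_subset) auto
  have "((\<lambda>t. (t, t)) has_derivative (\<lambda>h. (h, h))) (at t within {0..})"
    by (intro has_derivative_Pair has_derivative_ident)
  from has_derivative_in_compose[OF this D2] have "((\<lambda>t. f t t) has_derivative
      (\<lambda>h. integral {0..t} (\<lambda>s. m' (t - s) * a s) * h + m 0 * a t * h)) (at t within {0..})"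
    by simp
  moreover have "(\<lambda>h. integral {0..t} (\<lambda>s. m' (t - s) * a s) * h + m 0 * a t * h)
      = (*) (m 0 * a t + integral {0..t} (\<lambda>s. m' (t - s) * a s))"
    by (rule ext) (simp only: distrib_right add.commute)
  ultimately show ?thesis
    by (simp only: f_def has_field_derivative_def)
qed

lemma integral_reflect_Icc:
  fixes F :: "real \<Rightarrow> real"
  assumes F: "continuous_on {0..t} F"
  shows "integral {0..t} (\<lambda>s. F (t - s)) = integral {0..t} F"
proof -
  have c: "continuous_on {0..t} (\<lambda>s. F (t - s))"
    by (intro continuous_on_compose2[OF F] continuous_intros) auto
  have "(LBINT s:{0..t}. F (t - s)) = (LBINT s:{0..t}. F s)"
    unfolding set_lebesgue_integral_def
    by (subst (2) lborel_integral_real_affine[where c="-1" and t=t])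
      (auto simp: indicator_def intro!: Bochner_Integration.integral_cong)
  then show ?thesis
    by (simp add: set_borel_integral_eq_integral(2) borel_integrable_atLeastAtMost' c F)
qed

lemma volterra_asymptotics:
  fixes a g k m :: "real \<Rightarrow> real"
  defines "\<mu> \<equiv> (\<lambda>\<theta>. LBINT t:{0..}. exp (\<theta> * t) * m t)"
  assumes \<delta>: "0 < \<delta>" "\<delta> < \<sigma>" and \<theta>: "\<theta> \<le> \<delta>"
    and m: "\<And>t. (m has_real_derivative (- k t - \<theta> * m t)) (at t)" "m 0 = \<theta>"
    and k: "continuous_on UNIV k"
    and mb: "\<And>t. t \<ge> 0 \<Longrightarrow> \<bar>m t\<bar> \<le> B * exp (- \<sigma> * t)"
    and B: "B / (\<sigma> - \<delta>) \<le> 1 / 2"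
    and g: "continuous_on {0..} g" "\<And>t. t \<ge> 0 \<Longrightarrow> \<bar>g t\<bar> \<le> D * exp (- \<sigma> * t)"
    and a: "\<And>t. t \<ge> 0 \<Longrightarrow> (a has_real_derivative (g t - integral {0..t} (\<lambda>s. k (t - s) * a s))) (at t within {0..})"
  shows "\<exists>E. \<forall>t\<ge>0. \<bar>a t - (a 0 + (LBINT s:{0..}. exp (\<theta> * s) * g s)) / (1 - \<mu> \<theta>) * exp (- \<theta> * t)\<bar> \<le> E * exp (- \<delta> * t)"
proof -
  define J where "J = (LBINT s:{0..}. exp (\<theta> * s) * g s)"
  define \<alpha> where "\<alpha> = (a 0 + J) / (1 - \<mu> \<theta>)"
  have \<sigma>\<theta>: "\<sigma> - \<theta> > 0" "\<sigma> - \<theta> \<ge> \<sigma> - \<delta>" using \<delta> \<theta> by auto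
  have B0: "B \<ge> 0" and D0: "D \<ge> 0" using mb[of 0] g(2)[of 0] by auto
  have mc: "continuous_on S m" for S
    using m(1) by (meson DERIV_continuous continuous_at_imp_continuous_at_within continuous_on_eq_continuous_within)
  have ac: "continuous_on {0..} a"
    using a by (meson DERIV_continuous atLeast_iff continuous_on_eq_continuous_within)
  have tail: "\<bar>(LBINT s:{0..}. exp (\<theta> * s) * f s) - integral {0..t} (\<lambda>s. exp (\<theta> * s) * f s)\<bar> * exp (- \<theta> * t)
      \<le> F / (\<sigma> - \<theta>) * exp (- \<sigma> * t)" (is ?tail)
    and total: "\<bar>LBINT s:{0..}. exp (\<theta> * s) * f s\<bar> \<le> F / (\<sigma> - \<theta>)" (is ?total)
    if f: "continuous_on {0..} f" "\<And>t. t \<ge> 0 \<Longrightarrow> \<bar>f t\<bar> \<le> F * exp (- \<sigma> * t)" and t: "t \<ge> 0" for f F t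
  proof -
    have *: "set_integrable lborel {r..} (\<lambda>s. exp (\<theta> * s) * f s)"
      "norm (LBINT s:{r..}. exp (\<theta> * s) * f s) \<le> F * exp (- (\<sigma> - \<theta>) * r) / (\<sigma> - \<theta>)" if r: "r \<ge> 0" for r
    proof -
      have 1: "set_borel_measurable lborel {r..} (\<lambda>s. exp (\<theta> * s) * f s)"
        by (intro set_borel_measurable_continuous_atLeast continuous_intros continuous_on_subset[OF f(1)]) (use r in auto)
      have 2: "norm (exp (\<theta> * s) * f s) \<le> F * exp (- (\<sigma> - \<theta>) * s)" if "s \<ge> r" for s
      proof -
        have "norm (exp (\<theta> * s) * f s) \<le> exp (\<theta> * s) * (F * exp (- \<sigma> * s))"
          using f(2)[of s] r that by (simp add: abs_mult)
        then show ?thesis by (simp add: exp_add[symmetric] algebra_simps)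
      qed
      show "set_integrable lborel {r..} (\<lambda>s. exp (\<theta> * s) * f s)"
      "norm (LBINT s:{r..}. exp (\<theta> * s) * f s) \<le> F * exp (- (\<sigma> - \<theta>) * r) / (\<sigma> - \<theta>)"
        using set_integral_exp_bound[OF \<sigma>\<theta>(1) 1 2] by auto
    qed
    show ?total using *(2)[of 0] by simp
    have "\<bar>(LBINT s:{0..}. exp (\<theta> * s) * f s) - integral {0..t} (\<lambda>s. exp (\<theta> * s) * f s)\<bar> * exp (- \<theta> * t)
      \<le> F * exp (- (\<sigma> - \<theta>) * t) / (\<sigma> - \<theta>) * exp (- \<theta> * t)"
      using *(2)[OF t] by (intro mult_right_mono) (simp_all add: integral_atLeast_split[OF *(1)[of 0] t])
    then show ?tail by (simp add: exp_add[symmetric] algebra_simps)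
  qed
  have \<mu>1: "1 - \<mu> \<theta> \<noteq> 0"
  proof -
    have "\<bar>\<mu> \<theta>\<bar> \<le> B / (\<sigma> - \<theta>)" unfolding \<mu>_def by (rule total[OF mc mb]) auto
    also have "\<dots> \<le> B / (\<sigma> - \<delta>)" using \<sigma>\<theta> \<delta> B0 by (intro divide_left_mono) auto
    finally have "\<bar>\<mu> \<theta>\<bar> \<le> 1 / 2" using B by linarith
    then show ?thesis by auto
  qed
  have ci: "(\<lambda>s. f (t - s) * h s) integrable_on {0..t}"
    if "continuous_on UNIV f" "continuous_on {0..} h" for f h :: "real \<Rightarrow> real" and t
    by (intro integrable_continuous_interval continuous_intros continuous_on_compose2[OF that(1)] continuous_on_subset[OF that(2)]) auto
  \<comment> \<open>\<open>m' = - k - \<theta> m\<close> makes \<open>u = a - m * a\<close> solve the memoryless equation \<open>u' = g - \<theta> u\<close>.\<close>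
  define u where "u t = a t - integral {0..t} (\<lambda>s. m (t - s) * a s)" for t
  have u': "(u has_real_derivative (g t - \<theta> * u t)) (at t within {0..})" if t: "t \<ge> 0" for t
  proof -
    have kc: "continuous_on UNIV (\<lambda>t. - k t - \<theta> * m t)"
      by (intro continuous_intros k mc)
    have "integral {0..t} (\<lambda>s. (- k (t - s) - \<theta> * m (t - s)) * a s)
      = integral {0..t} (\<lambda>s. - (k (t - s) * a s) - \<theta> * (m (t - s) * a s))"
      by (simp add: algebra_simps)
    also have "\<dots> = - integral {0..t} (\<lambda>s. k (t - s) * a s) - \<theta> * integral {0..t} (\<lambda>s. m (t - s) * a s)"
      using integral_diff[OF integrable_neg[OF ci[OF k ac]] integrable_cmul[OF ci[OF mc ac], of \<theta>]] by simp
    finally show ?thesis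
      unfolding u_def
      by (intro DERIV_cong[OF DERIV_diff[OF a[OF t] convolution_has_derivative[OF m(1) kc ac t]]])
        (simp add: m(2) algebra_simps)
  qed
  have u_bound: "\<bar>u t - (a 0 + J) * exp (- \<theta> * t)\<bar> \<le> D / (\<sigma> - \<theta>) * exp (- \<sigma> * t)" if t: "t \<ge> 0" for t
  proof -
    have "((\<lambda>s. exp (\<theta> * s) * g s) has_integral exp (\<theta> * t) * u t - exp (\<theta> * 0) * u 0) {0..t}"
    proof (rule fundamental_theorem_of_calculus[OF t])
      fix s assume s: "s \<in> {0..t}"
      have "((\<lambda>s. exp (\<theta> * s) * u s) has_real_derivative exp (\<theta> * s) * g s) (at s within {0..})"
      proof -
        have e: "((\<lambda>s. exp (\<theta> * s)) has_real_derivative exp (\<theta> * s) * \<theta>) (at s within {0..})"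
          by (rule derivative_eq_intros refl)+ simp
        show ?thesis
          by (rule DERIV_cong[OF DERIV_mult[OF e u'[of s]]]) (use s in \<open>auto simp: algebra_simps\<close>)
      qed
      then have "((\<lambda>s. exp (\<theta> * s) * u s) has_real_derivative exp (\<theta> * s) * g s) (at s within {0..t})"
        by (rule DERIV_subset) auto
      then show "((\<lambda>s. exp (\<theta> * s) * u s) has_vector_derivative exp (\<theta> * s) * g s) (at s within {0..t})"
        by (simp add: has_real_derivative_iff_has_vector_derivative)
    qed
    then have I: "integral {0..t} (\<lambda>s. exp (\<theta> * s) * g s) = exp (\<theta> * t) * u t - a 0"
      by (simp add: integral_unique u_def)
    have "u t = (exp (\<theta> * t) * u t) * exp (- \<theta> * t)" by (simp add: exp_minus)
    then have "u t - (a 0 + J) * exp (- \<theta> * t) = - ((J - integral {0..t} (\<lambda>s. exp (\<theta> * s) * g s)) * exp (- \<theta> * t))"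
      unfolding I by (simp add: algebra_simps)
    then show ?thesis using tail[OF g t] by (simp add: J_def abs_mult)
  qed
  define v where "v t = exp (- \<theta> * t) - integral {0..t} (\<lambda>s. m (t - s) * exp (- \<theta> * s))" for t
  have v_bound: "\<bar>v t - (1 - \<mu> \<theta>) * exp (- \<theta> * t)\<bar> \<le> B / (\<sigma> - \<theta>) * exp (- \<sigma> * t)" if t: "t \<ge> 0" for t
  proof -
    have "integral {0..t} (\<lambda>s. m (t - s) * exp (- \<theta> * s)) = integral {0..t} (\<lambda>s. exp (- \<theta> * t) * (exp (\<theta> * (t - s)) * m (t - s)))"
      by (intro integral_cong) (simp add: exp_add[symmetric] algebra_simps)
    also have "\<dots> = exp (- \<theta> * t) * integral {0..t} (\<lambda>s. exp (\<theta> * (t - s)) * m (t - s))"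
      by simp
    also have "integral {0..t} (\<lambda>s. exp (\<theta> * (t - s)) * m (t - s)) = integral {0..t} (\<lambda>s. exp (\<theta> * s) * m s)"
      by (intro integral_reflect_Icc continuous_intros mc)
    finally have "v t - (1 - \<mu> \<theta>) * exp (- \<theta> * t) = (\<mu> \<theta> - integral {0..t} (\<lambda>s. exp (\<theta> * s) * m s)) * exp (- \<theta> * t)"
      by (simp add: v_def algebra_simps)
    then show ?thesis using tail[OF mc mb t] by (simp add: \<mu>_def abs_mult)
  qed
  define b where "b t = a t - \<alpha> * exp (- \<theta> * t)" for t
  define F where "F = D / (\<sigma> - \<theta>) + \<bar>\<alpha>\<bar> * (B / (\<sigma> - \<theta>))"
  have F0: "F \<ge> 0" unfolding F_def using D0 B0 \<sigma>\<theta> by simp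
  have bc: "continuous_on {0..} b" unfolding b_def by (intro continuous_intros ac)
  have b_eq: "\<bar>b t - integral {0..t} (\<lambda>s. m (t - s) * b s)\<bar> \<le> F * exp (- \<delta> * t)" if t: "t \<ge> 0" for t
  proof -
    have ec: "continuous_on {0..} (\<lambda>s. exp (- \<theta> * s))" by (intro continuous_intros)
    have "integral {0..t} (\<lambda>s. m (t - s) * b s) = integral {0..t} (\<lambda>s. m (t - s) * a s - \<alpha> * (m (t - s) * exp (- \<theta> * s)))"
      by (simp add: b_def algebra_simps)
    also have "\<dots> = integral {0..t} (\<lambda>s. m (t - s) * a s) - \<alpha> * integral {0..t} (\<lambda>s. m (t - s) * exp (- \<theta> * s))"
      using integral_diff[OF ci[OF mc ac] integrable_cmul[OF ci[OF mc ec], of \<alpha>]] by simp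
    finally have "b t - integral {0..t} (\<lambda>s. m (t - s) * b s) = u t - \<alpha> * v t"
      by (simp add: b_def u_def v_def algebra_simps)
    also have "\<dots> = (u t - (a 0 + J) * exp (- \<theta> * t)) - \<alpha> * (v t - (1 - \<mu> \<theta>) * exp (- \<theta> * t))"
      using \<mu>1 by (simp add: \<alpha>_def field_simps)
    finally have eq: "b t - integral {0..t} (\<lambda>s. m (t - s) * b s)
      = (u t - (a 0 + J) * exp (- \<theta> * t)) - \<alpha> * (v t - (1 - \<mu> \<theta>) * exp (- \<theta> * t))" .
    have "\<bar>b t - integral {0..t} (\<lambda>s. m (t - s) * b s)\<bar> \<le>
        \<bar>u t - (a 0 + J) * exp (- \<theta> * t)\<bar> + \<bar>\<alpha>\<bar> * \<bar>v t - (1 - \<mu> \<theta>) * exp (- \<theta> * t)\<bar>"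
      unfolding eq abs_mult[symmetric] by (rule abs_triangle_ineq4)
    also have "\<dots> \<le> D / (\<sigma> - \<theta>) * exp (- \<sigma> * t) + \<bar>\<alpha>\<bar> * (B / (\<sigma> - \<theta>) * exp (- \<sigma> * t))"
      by (intro add_mono mult_left_mono u_bound v_bound t) auto
    also have "\<dots> = F * exp (- \<sigma> * t)" by (simp add: F_def algebra_simps)
    also have "\<dots> \<le> F * exp (- \<delta> * t)" using mult_right_mono[of \<delta> \<sigma> t] F0 \<delta> t by (intro mult_left_mono) auto
    finally show ?thesis .
  qed
  have "\<bar>b T\<bar> \<le> 2 * F * exp (- \<delta> * T)" if T: "T \<ge> 0" for T
  proof -
    define y where "y t = exp (\<delta> * t) * \<bar>b t\<bar>" for t
    have "continuous_on {0..T} y" unfolding y_def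
      by (intro continuous_intros continuous_on_subset[OF bc]) auto
    then obtain t where t: "t \<in> {0..T}" "\<And>s. s \<in> {0..T} \<Longrightarrow> y s \<le> y t"
      using continuous_attains_sup[of "{0..T}" y] T by auto
    have bs: "\<bar>b s\<bar> \<le> y t * exp (- \<delta> * s)" if "s \<in> {0..T}" for s
      using t(2)[OF that] by (simp add: y_def exp_minus field_simps)
    have y0: "y t \<ge> 0" by (simp add: y_def)
    let ?h = "\<lambda>s. B * y t * exp (- \<delta> * t) * exp (- (\<sigma> - \<delta>) * (t - s))"
    have hi: "(?h has_integral B * y t * exp (- \<delta> * t) * (exp (- (\<sigma> - \<delta>) * (t - t)) / (\<sigma> - \<delta>))
        - B * y t * exp (- \<delta> * t) * (exp (- (\<sigma> - \<delta>) * (t - 0)) / (\<sigma> - \<delta>))) {0..t}"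
    proof (rule fundamental_theorem_of_calculus)
      fix s
      have "((\<lambda>s. B * y t * exp (- \<delta> * t) * (exp (- (\<sigma> - \<delta>) * (t - s)) / (\<sigma> - \<delta>))) has_real_derivative ?h s) (at s within {0..t})"
      proof -
        have e: "((\<lambda>s. exp (- (\<sigma> - \<delta>) * (t - s))) has_real_derivative exp (- (\<sigma> - \<delta>) * (t - s)) * (\<sigma> - \<delta>)) (at s within {0..t})"
          by (rule derivative_eq_intros refl)+ simp
        show ?thesis
          by (rule DERIV_cong[OF DERIV_cmult[OF DERIV_cdivide[OF e]]]) (use \<delta> in simp)
      qed
      then show "((\<lambda>s. B * y t * exp (- \<delta> * t) * (exp (- (\<sigma> - \<delta>) * (t - s)) / (\<sigma> - \<delta>))) has_vector_derivative ?h s) (at s within {0..t})"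
        by (simp only: has_real_derivative_iff_has_vector_derivative)
    qed (use t(1) in simp)
    have "norm (integral {0..t} (\<lambda>s. m (t - s) * b s)) \<le> integral {0..t} ?h"
    proof (rule integral_norm_bound_integral[OF ci[OF mc bc]])
      show "?h integrable_on {0..t}" using hi by blast
      fix s assume s: "s \<in> {0..t}"
      have "norm (m (t - s) * b s) \<le> (B * exp (- \<sigma> * (t - s))) * (y t * exp (- \<delta> * s))"
        unfolding real_norm_def abs_mult using s t(1) by (intro mult_mono' mb bs) auto
      also have "\<dots> = ?h s" by (simp add: exp_add[symmetric] algebra_simps)
      finally show "norm (m (t - s) * b s) \<le> ?h s" .
    qed
    also have "\<dots> \<le> B * y t * exp (- \<delta> * t) / (\<sigma> - \<delta>)"
      using integral_unique[OF hi] B0 y0 \<delta> by simp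
    also have "\<dots> = (B / (\<sigma> - \<delta>)) * (y t * exp (- \<delta> * t))" by simp
    also have "\<dots> \<le> 1 / 2 * (y t * exp (- \<delta> * t))"
      using B y0 by (intro mult_right_mono) auto
    finally have "\<bar>b t\<bar> \<le> F * exp (- \<delta> * t) + 1 / 2 * (y t * exp (- \<delta> * t))"
      using b_eq[of t] t(1) by simp
    moreover have "\<bar>b t\<bar> = y t * exp (- \<delta> * t)" by (simp add: y_def exp_minus)
    ultimately have "y t * exp (- \<delta> * t) \<le> 2 * F * exp (- \<delta> * t)" by linarith
    then have "y t \<le> 2 * F" by simp
    then have "y t * exp (- \<delta> * T) \<le> 2 * F * exp (- \<delta> * T)" by (intro mult_right_mono) auto
    moreover have "\<bar>b T\<bar> \<le> y t * exp (- \<delta> * T)" by (rule bs) (use T in simp)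
    ultimately show ?thesis by linarith
  qed
  then show ?thesis unfolding b_def \<alpha>_def J_def by blast
qed

subsection \<open>Reduction of the system to a Volterra equation\<close>

lemma lebesgue_integral_cong_AE:
  fixes f g :: "real \<Rightarrow> 'b::euclidean_space"
  assumes "g \<in> borel_measurable lebesgue" "AE x in lebesgue. f x = g x"
  shows "(LINT x|lebesgue. f x) = (LINT x|lebesgue. g x)"
proof (rule integral_cong_AE)
  show "f \<in> borel_measurable lebesgue"
    by (rule borel_measurable_AE[OF assms(1)]) (use assms(2) in auto)
qed (use assms in auto)

lemma AE_lebesgue_shift:
  fixes s :: real
  assumes "AE x in lebesgue. P x"
  shows "AE x in lebesgue. P (s + x)"
  using AE_lborel_shift[of P s] assms by (simp add: AE_completion_iff)

lemma L2_lincomb: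
  assumes f: "L2 f" and g: "L2 g"
  shows "L2 (\<lambda>x. c * f x + d * g x)"
proof -
  have m: "f \<in> borel_measurable lebesgue" "g \<in> borel_measurable lebesgue"
    and i: "integrable lebesgue (\<lambda>x. (norm (f x))\<^sup>2)" "integrable lebesgue (\<lambda>x. (norm (g x))\<^sup>2)"
    using f g by (auto simp: L2_def)
  have m': "(\<lambda>x. c * f x + d * g x) \<in> borel_measurable lebesgue"
    by (intro borel_measurable_add borel_measurable_times m) auto
  have "integrable lebesgue (\<lambda>x. 2 * (norm c)\<^sup>2 * (norm (f x))\<^sup>2 + 2 * (norm d)\<^sup>2 * (norm (g x))\<^sup>2)"
    by (intro Bochner_Integration.integrable_add integrable_mult_right i)
  then have "integrable lebesgue (\<lambda>x. (norm (c * f x + d * g x))\<^sup>2)"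
  proof (rule Bochner_Integration.integrable_bound)
    have "(norm (c * f x + d * g x))\<^sup>2 \<le> 2 * (norm c)\<^sup>2 * (norm (f x))\<^sup>2 + 2 * (norm d)\<^sup>2 * (norm (g x))\<^sup>2" for x
    proof -
      have "(norm (c * f x + d * g x))\<^sup>2 \<le> (norm (c * f x) + norm (d * g x))\<^sup>2"
        by (intro power_mono norm_triangle_ineq) auto
      also have "\<dots> \<le> 2 * (norm (c * f x))\<^sup>2 + 2 * (norm (d * g x))\<^sup>2"
        using zero_le_power2[of "norm (c * f x) - norm (d * g x)"] by (simp add: power2_eq_square algebra_simps)
      finally show ?thesis by (simp add: norm_mult power_mult_distrib)
    qed
    then show "AE x in lebesgue. norm ((norm (c * f x + d * g x))\<^sup>2)
        \<le> norm (2 * (norm c)\<^sup>2 * (norm (f x))\<^sup>2 + 2 * (norm d)\<^sup>2 * (norm (g x))\<^sup>2)"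
      by (intro AE_I2) (auto intro: order_trans[OF _ abs_ge_self])
  qed (use m' in measurable)
  with m' show ?thesis by (simp add: L2_def)
qed

lemma
  fixes \<eta> :: "real \<Rightarrow> real"
  assumes f: "L2 f" and \<eta>: "\<eta> \<in> borel_measurable lebesgue" "integrable lebesgue (\<lambda>x. (\<eta> x)\<^sup>2)"
  shows L2_pairing_integrable: "integrable lebesgue (\<lambda>x. f x * of_real (\<eta> x))"
    and L2_pairing_bound: "norm (LINT x|lebesgue. f x * of_real (\<eta> x)) \<le> (1 + (LINT x|lebesgue. (\<eta> x)\<^sup>2)) / 2 * L2norm f"
proof -
  define b where "b = (LINT x|lebesgue. (\<eta> x)\<^sup>2)"
  have fm: "f \<in> borel_measurable lebesgue" and fi: "integrable lebesgue (\<lambda>x. (norm (f x))\<^sup>2)"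
    using f by (auto simp: L2_def)
  have "r > 0 \<Longrightarrow> norm (f x * of_real (\<eta> x)) \<le> ((norm (f x))\<^sup>2 / r + r * (\<eta> x)\<^sup>2) / 2" for r x
  proof -
    assume r: "r > 0"
    have "0 \<le> (norm (f x) - r * \<bar>\<eta> x\<bar>)\<^sup>2 / r" using r by simp
    also have "\<dots> = (norm (f x))\<^sup>2 / r + r * (\<eta> x)\<^sup>2 - 2 * (norm (f x) * \<bar>\<eta> x\<bar>)"
      using r by (simp add: power2_diff field_simps power2_eq_square)
    finally show ?thesis by (simp add: norm_mult)
  qed
  note am_gm = this
  have bd: "integrable lebesgue (\<lambda>x. ((norm (f x))\<^sup>2 / r + r * (\<eta> x)\<^sup>2) / 2)" for r
    using fi \<eta>(2) by simp
  show i: "integrable lebesgue (\<lambda>x. f x * of_real (\<eta> x))"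
  proof (rule Bochner_Integration.integrable_bound[OF bd[of 1]])
    show "(\<lambda>x. f x * of_real (\<eta> x)) \<in> borel_measurable lebesgue"
      using fm \<eta>(1) by measurable
    show "AE x in lebesgue. norm (f x * of_real (\<eta> x)) \<le> norm (((norm (f x))\<^sup>2 / 1 + 1 * (\<eta> x)\<^sup>2) / 2)"
      by (intro AE_I2 order_trans[OF am_gm[of 1]]) auto
  qed
  have I: "norm (LINT x|lebesgue. f x * of_real (\<eta> x)) \<le> ((L2norm f)\<^sup>2 / r + r * b) / 2" if "r > 0" for r
  proof -
    have "norm (LINT x|lebesgue. f x * of_real (\<eta> x)) \<le> (LINT x|lebesgue. norm (f x * of_real (\<eta> x)))"
      by (rule integral_norm_bound)
    also have "\<dots> \<le> (LINT x|lebesgue. ((norm (f x))\<^sup>2 / r + r * (\<eta> x)\<^sup>2) / 2)"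
      by (rule integral_mono[OF integrable_norm[OF i] bd]) (rule am_gm[OF that])
    also have "\<dots> = ((LINT x|lebesgue. (norm (f x))\<^sup>2) / r + r * b) / 2"
      using fi \<eta>(2) by (simp add: b_def)
    also have "(LINT x|lebesgue. (norm (f x))\<^sup>2) = (L2norm f)\<^sup>2"
      by (simp add: L2norm_def)
    finally show ?thesis .
  qed
  have "L2norm f \<ge> 0" by (simp add: L2norm_def)
  moreover have "b \<ge> 0" by (simp add: b_def)
  ultimately have "norm (LINT x|lebesgue. f x * of_real (\<eta> x)) \<le> (1 + b) / 2 * L2norm f"
  proof (cases "L2norm f = 0")
    case True
    have "norm (LINT x|lebesgue. f x * of_real (\<eta> x)) \<le> 0 + e" if e: "e > 0" for e
    proof -
      have "e / (1 + b) > 0" using e \<open>b \<ge> 0\<close> by simp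
      from I[OF this] have "norm (LINT x|lebesgue. f x * of_real (\<eta> x)) \<le> e * (b / (1 + b)) / 2"
        by (simp add: True)
      also have "\<dots> \<le> e * 1 / 2" using e \<open>b \<ge> 0\<close> by (intro divide_right_mono mult_left_mono) auto
      finally show ?thesis using e by simp
    qed
    then have "norm (LINT x|lebesgue. f x * of_real (\<eta> x)) \<le> 0" by (rule field_le_epsilon)
    then show ?thesis by (simp add: True)
  next
    case False
    then have pos: "L2norm f > 0" using \<open>L2norm f \<ge> 0\<close> by simp
    from I[OF this] show ?thesis using pos by (simp add: power2_eq_square algebra_simps)
  qed
  then show "norm (LINT x|lebesgue. f x * of_real (\<eta> x)) \<le> (1 + (LINT x|lebesgue. (\<eta> x)\<^sup>2)) / 2 * L2norm f"
    by (simp add: b_def)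
qed

lemma C1_L2_pairing_derivative:
  fixes \<eta> :: "real \<Rightarrow> real"
  assumes u: "C1_L2 u u'" and \<eta>: "\<eta> \<in> borel_measurable lebesgue" "integrable lebesgue (\<lambda>x. (\<eta> x)\<^sup>2)"
  shows "((\<lambda>t. LINT x|lebesgue. u t x * of_real (\<eta> x)) has_vector_derivative
      (LINT x|lebesgue. u' t x * of_real (\<eta> x))) (at t)"
proof -
  define Y where "Y t = (LINT x|lebesgue. u t x * of_real (\<eta> x))" for t
  define Y' where "Y' t = (LINT x|lebesgue. u' t x * of_real (\<eta> x))" for t
  define Q where "Q h x = (u (t + h) x - u t x) / of_real h - u' t x" for h x
  define c where "c = (1 + (LINT x|lebesgue. (\<eta> x)\<^sup>2)) / 2"
  have L: "L2 (u t)" "L2 (u' t)" for t using u by (auto simp: C1_L2_def)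
  have Q: "L2 (Q h)" for h
  proof -
    have "L2 (\<lambda>x. (1 / of_real h) * (1 * u (t + h) x + (- 1) * u t x) + (- 1) * u' t x)"
      by (intro L2_lincomb L)
    then show ?thesis by (simp add: Q_def[abs_def] field_simps)
  qed
  note i = L2_pairing_integrable[OF L(1) \<eta>] L2_pairing_integrable[OF L(2) \<eta>]
  have bound: "norm (Y (t + h) - Y t - h *\<^sub>R Y' t) / norm h \<le> c * L2norm (Q h)" if "h \<noteq> 0" for h
  proof -
    have "(LINT x|lebesgue. Q h x * of_real (\<eta> x))
       = (LINT x|lebesgue. (1 / of_real h) * (u (t + h) x * of_real (\<eta> x) - u t x * of_real (\<eta> x)) - u' t x * of_real (\<eta> x))"
      by (rule Bochner_Integration.integral_cong) (auto simp: Q_def field_simps)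
    also have "\<dots> = (1 / of_real h) * (Y (t + h) - Y t) - Y' t"
      using i by (simp add: Y_def Y'_def del: of_real_divide)
    finally have "Y (t + h) - Y t - h *\<^sub>R Y' t = of_real h * (LINT x|lebesgue. Q h x * of_real (\<eta> x))"
      using that by (simp add: scaleR_conv_of_real field_simps)
    then have "norm (Y (t + h) - Y t - h *\<^sub>R Y' t) / norm h = norm (LINT x|lebesgue. Q h x * of_real (\<eta> x))"
      using that by (simp add: norm_mult)
    then show ?thesis using L2_pairing_bound[OF Q \<eta>] by (simp add: c_def)
  qed
  have "((\<lambda>h. L2norm (Q h)) \<longlongrightarrow> 0) (at 0)"
    using u by (simp add: C1_L2_def Q_def[abs_def])
  then have "((\<lambda>h. c * L2norm (Q h)) \<longlongrightarrow> c * 0) (at 0)" by (intro tendsto_intros)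
  then have lim: "((\<lambda>h. c * L2norm (Q h)) \<longlongrightarrow> 0) (at 0)" by simp
  have "(\<lambda>h. norm (Y (t + h) - Y t - h *\<^sub>R Y' t) / norm h) \<midarrow>0\<rightarrow> 0"
    by (rule tendsto_sandwich[OF _ _ tendsto_const lim])
      (use bound in \<open>auto simp: eventually_at_filter\<close>)
  then have "(Y has_vector_derivative Y' t) (at t)"
    unfolding has_vector_derivative_def has_derivative_at by (simp add: bounded_linear_scaleR_left)
  then show ?thesis by (simp add: Y_def[abs_def] Y'_def)
qed

context decaying_profile
begin

text \<open>Duhamel's formula, paired with the profile \<open>q (x - T)\<close>.\<close>

lemma solution_volterra:
  assumes sol: "is_solution q0 \<omega> \<psi>\<^sub>0 a\<^sub>0 \<psi> a" and q0: "AE x in lebesgue. q0 x = q x" and \<omega>: "\<omega> \<noteq> 0"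
    and [measurable]: "f1 \<in> borel_measurable borel" "f2 \<in> borel_measurable borel"
    and f1: "\<And>x. \<bar>f1 x\<bar> \<le> B * exp (- \<rho> * \<bar>x\<bar>)" and f2: "\<And>x. \<bar>f2 x\<bar> \<le> B * exp (- \<rho> * \<bar>x\<bar>)"
    and \<psi>0: "AE x in lebesgue. \<psi>\<^sub>0 x = Complex (f1 x) (f2 x)" and T: "T \<ge> 0"
  shows "(a has_real_derivative
      (- (1 / \<omega>) * (cos (\<omega> * T) * corr f1 q T - sin (\<omega> * T) * corr f2 q T)
       - integral {0..T} (\<lambda>s. (cos (\<omega> * (T - s)) * corr q q (T - s)) * a s))) (at T)"
proof -
  from sol obtain \<psi>' a' where
    C1: "C1_L2 \<psi> \<psi>'"
    and a': "\<And>t. (a has_real_derivative a' t) (at t)"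
    and \<psi>': "\<And>t. AE x in lebesgue. \<psi>' t x = \<i> * of_real \<omega> * \<psi> t x + of_real (\<omega> * a t * q0 (x - t))"
    and a'_eq: "\<And>t. a' t = - (1 / \<omega>) * (LINT x|lebesgue. Re (\<psi> t x) * q0 (x - t))"
    and init: "AE x in lebesgue. \<psi> 0 x = \<psi>\<^sub>0 x"
    unfolding is_solution_def by blast
  have L: "L2 (\<psi> t)" "L2 (\<psi>' t)" for t using C1 by (auto simp: C1_L2_def)
  define \<eta> where "\<eta> x = q (x - T)" for x
  have \<eta>b[measurable]: "\<eta> \<in> borel_measurable borel" unfolding \<eta>_def by measurable
  have \<eta>l: "\<eta> \<in> borel_measurable lebesgue" by (intro measurable_completion) simp
  have "integrable lborel (\<lambda>x. q x * q (x - 0))"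
    by (rule corr_integrable[OF q_borel q_bound])
  then have "integrable lborel (\<lambda>x. (q x)\<^sup>2)" by (simp add: power2_eq_square)
  from lborel_integrable_real_affine[OF this, of 1 "- T"]
  have \<eta>2: "integrable lebesgue (\<lambda>x. (\<eta> x)\<^sup>2)"
    by (simp add: \<eta>_def integrable_completion)
  have q0s: "AE x in lebesgue. q0 (x - t) = q (x - t)" for t
    using AE_lebesgue_shift[OF q0, of "- t"] by (simp add: add.commute)
  define Y where "Y t = (LINT x|lebesgue. \<psi> t x * of_real (\<eta> x))" for t
  have qq: "(LBINT x. q (x - t) * q (x - T)) = corr q q (T - t)" for t
    unfolding corr_def
    by (subst lborel_integral_real_affine[where c=1 and t=t]) (simp_all add: algebra_simps)
  have qqi: "integrable lborel (\<lambda>x. q (x - t) * q (x - T))" for t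
  proof -
    have "integrable lborel (\<lambda>x. q x * q (x - (T - t)))"
      by (rule corr_integrable[OF q_borel q_bound])
    from lborel_integrable_real_affine[OF this, of 1 "- t"] show ?thesis
      by (simp add: algebra_simps)
  qed
  have pair': "(LINT x|lebesgue. \<psi>' t x * of_real (\<eta> x)) = \<i> * of_real \<omega> * Y t + of_real (\<omega> * a t * corr q q (T - t))" for t
  proof -
    have m: "(\<lambda>x. \<i> * of_real \<omega> * (\<psi> t x * of_real (\<eta> x)) + of_real (\<omega> * a t) * of_real (q (x - t) * q (x - T))) \<in> borel_measurable lebesgue"
    proof -
      have "\<psi> t \<in> borel_measurable lebesgue" using L by (simp add: L2_def)
      moreover have "(\<lambda>x. complex_of_real (q (x - t) * q (x - T))) \<in> borel_measurable lebesgue"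
        by (intro measurable_completion) measurable
      ultimately show ?thesis
        using \<eta>l by measurable
    qed
    have "(LINT x|lebesgue. \<psi>' t x * of_real (\<eta> x))
      = (LINT x|lebesgue. \<i> * of_real \<omega> * (\<psi> t x * of_real (\<eta> x)) + of_real (\<omega> * a t) * of_real (q (x - t) * q (x - T)))"
      by (rule lebesgue_integral_cong_AE[OF m])
        (use \<psi>'[of t] q0s[of t] in \<open>eventually_elim, simp add: \<eta>_def algebra_simps\<close>)
    also have "\<dots> = \<i> * of_real \<omega> * Y t + of_real (\<omega> * a t) * of_real (LINT x|lebesgue. q (x - t) * q (x - T))"
    proof -
      have 1: "integrable lebesgue (\<lambda>x. \<psi> t x * of_real (\<eta> x))"
        by (rule L2_pairing_integrable[OF L(1) \<eta>l \<eta>2])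
      have 2: "integrable lebesgue (\<lambda>x. q (x - t) * q (x - T))"
        using qqi[of t] by (simp add: integrable_completion)
      show ?thesis
        using Bochner_Integration.integral_add[OF integrable_mult_right[OF 1, of "\<i> * of_real \<omega>"]
            integrable_mult_right[OF integrable_of_real[OF 2], of "of_real (\<omega> * a t)"]]
        by (simp only: Y_def integral_mult_right_zero integral_complex_of_real)
    qed
    also have "(LINT x|lebesgue. q (x - t) * q (x - T)) = corr q q (T - t)"
      by (simp add: integral_completion qq)
    finally show ?thesis by simp
  qed
  have Y': "(Y has_vector_derivative (\<i> * of_real \<omega> * Y t + of_real (\<omega> * a t * corr q q (T - t)))) (at t)" for t
    using C1_L2_pairing_derivative[OF C1 \<eta>l \<eta>2, of t] by (simp only: pair' Y_def[abs_def])
  define Z where "Z t = exp (\<i> * of_real (\<omega> * (T - t))) * Y t" for t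
  have Z': "(Z has_vector_derivative exp (\<i> * of_real (\<omega> * (T - t))) * of_real (\<omega> * a t * corr q q (T - t))) (at t)" for t
  proof -
    have "((\<lambda>t. exp (\<i> * of_real (\<omega> * (T - t)))) has_vector_derivative (- \<i> * of_real \<omega> * exp (\<i> * of_real (\<omega> * (T - t))))) (at t)"
    proof -
      have "((\<lambda>z. exp (\<i> * (of_real \<omega> * (of_real T - z)))) has_field_derivative
          (- \<i> * of_real \<omega> * exp (\<i> * (of_real \<omega> * (of_real T - of_real t))))) (at (of_real t))"
        by (auto intro!: derivative_eq_intros)
      from has_vector_derivative_real_field[OF this] show ?thesis by simp
    qed
    from has_vector_derivative_mult[OF this Y'[of t]] show ?thesis
      unfolding Z_def by (rule has_vector_derivative_eq_rhs) (simp add: algebra_simps)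
  qed
  have "((\<lambda>t. exp (\<i> * of_real (\<omega> * (T - t))) * of_real (\<omega> * a t * corr q q (T - t))) has_integral Z T - Z 0) {0..T}"
    using Z' T by (intro fundamental_theorem_of_calculus) (auto intro: has_vector_derivative_at_within)
  from has_integral_linear[OF this bounded_linear_Re]
  have "((\<lambda>t. \<omega> * ((cos (\<omega> * (T - t)) * corr q q (T - t)) * a t)) has_integral Re (Z T) - Re (Z 0)) {0..T}"
    by (simp add: o_def Re_exp mult_ac)
  from has_integral_mult_right[OF this, of "1 / \<omega>"]
  have I: "integral {0..T} (\<lambda>t. (cos (\<omega> * (T - t)) * corr q q (T - t)) * a t) = (1 / \<omega>) * (Re (Z T) - Re (Z 0))"
    using \<omega> by (intro integral_unique) simp
  have "Y 0 = (LINT x|lebesgue. of_real (f1 x * \<eta> x) + \<i> * of_real (f2 x * \<eta> x))"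
    unfolding Y_def
  proof (rule lebesgue_integral_cong_AE)
    show "(\<lambda>x. of_real (f1 x * \<eta> x) + \<i> * of_real (f2 x * \<eta> x)) \<in> borel_measurable lebesgue"
      by (intro measurable_completion) measurable
    show "AE x in lebesgue. \<psi> 0 x * of_real (\<eta> x) = of_real (f1 x * \<eta> x) + \<i> * of_real (f2 x * \<eta> x)"
      using init \<psi>0 by eventually_elim (simp add: complex_eq_iff)
  qed
  also have "\<dots> = (LBINT x. of_real (f1 x * \<eta> x) + \<i> * of_real (f2 x * \<eta> x))"
    by (rule integral_completion) measurable
  also have "\<dots> = of_real (corr f1 q T) + \<i> * of_real (corr f2 q T)"
    using Bochner_Integration.integral_add[OF integrable_of_real[OF corr_integrable[OF _ f1]]
        integrable_mult_right[OF integrable_of_real[OF corr_integrable[OF _ f2]], of \<i>], of T T]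
    by (simp only: corr_def \<eta>_def integral_mult_right_zero integral_complex_of_real) simp
  finally have Y0: "Re (Z 0) = cos (\<omega> * T) * corr f1 q T - sin (\<omega> * T) * corr f2 q T"
    by (simp add: Z_def Re_exp Im_exp)
  have "(LINT x|lebesgue. Re (\<psi> T x) * q0 (x - T)) = (LINT x|lebesgue. Re (\<psi> T x * of_real (\<eta> x)))"
  proof (rule lebesgue_integral_cong_AE)
    show "(\<lambda>x. Re (\<psi> T x * of_real (\<eta> x))) \<in> borel_measurable lebesgue"
      using L2_pairing_integrable[OF L(1) \<eta>l \<eta>2, of T] by (intro borel_measurable_integrable integrable_Re)
    show "AE x in lebesgue. Re (\<psi> T x) * q0 (x - T) = Re (\<psi> T x * of_real (\<eta> x))"
      using q0s[of T] by eventually_elim (simp add: \<eta>_def)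
  qed
  also have "\<dots> = Re (Z T)"
    using integral_Re[OF L2_pairing_integrable[OF L(1) \<eta>l \<eta>2, of T]] by (simp add: Y_def Z_def)
  finally have "a' T = - (1 / \<omega>) * Re (Z T)" using a'_eq[of T] by simp
  also have "\<dots> = - (1 / \<omega>) * Re (Z 0) - (1 / \<omega>) * (Re (Z T) - Re (Z 0))" by (simp add: algebra_simps)
  finally have "a' T = - (1 / \<omega>) * (cos (\<omega> * T) * corr f1 q T - sin (\<omega> * T) * corr f2 q T)
      - integral {0..T} (\<lambda>s. (cos (\<omega> * (T - s)) * corr q q (T - s)) * a s)"
    by (simp only: I Y0)
  then show ?thesis using a'[of T] by simp
qed

end

subsection \<open>The resonance\<close>

lemma decaying_profile_exp_weight:
  assumes \<rho>: "\<rho> > 0" and [measurable]: "p \<in> borel_measurable borel"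
    and p: "\<And>x. \<bar>p x\<bar> \<le> L" "\<And>h. h \<ge> 0 \<Longrightarrow> AE x in lborel. \<bar>p (x + h) - p x\<bar> \<le> L * h"
  shows "decaying_profile (\<lambda>x. exp (- \<rho> * \<bar>x\<bar>) * p x) \<rho> (L * (exp \<rho> * (1 + \<rho>)))"
proof
  have L: "L \<ge> 0" using p(1)[of 0] by simp
  have "1 * 1 \<le> exp \<rho> * (1 + \<rho>)" using \<rho> by (intro mult_mono) auto
  then have "L * 1 \<le> L * (exp \<rho> * (1 + \<rho>))" using L by (intro mult_left_mono) auto
  then have LL: "L \<le> L * (exp \<rho> * (1 + \<rho>))" by simp
  show "\<bar>exp (- \<rho> * \<bar>x\<bar>) * p x\<bar> \<le> L * (exp \<rho> * (1 + \<rho>)) * exp (- \<rho> * \<bar>x\<bar>)" for x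
    using mult_right_mono[OF order_trans[OF p(1)[of x] LL], of "exp (- \<rho> * \<bar>x\<bar>)"] by (simp add: abs_mult mult_ac)
  show "(\<lambda>x. exp (- \<rho> * \<bar>x\<bar>) * p x) \<in> borel_measurable borel" by measurable
  show "\<rho> > 0" by fact
  fix h :: real assume h: "0 \<le> h" "h \<le> 1"
  show "AE x in lborel. \<bar>exp (- \<rho> * \<bar>x + h\<bar>) * p (x + h) - exp (- \<rho> * \<bar>x\<bar>) * p x\<bar>
      \<le> L * (exp \<rho> * (1 + \<rho>)) * h * exp (- \<rho> * \<bar>x\<bar>)"
    using p(2)[OF h(1)]
  proof eventually_elim
    case (elim x)
    define y where "y = \<rho> * (\<bar>x\<bar> - \<bar>x + h\<bar>)"
    have "\<bar>\<bar>x\<bar> - \<bar>x + h\<bar>\<bar> \<le> h" using h by linarith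
    then have y: "\<bar>y\<bar> \<le> \<rho> * h" using \<rho> by (simp add: y_def abs_mult)
    also have "\<dots> \<le> \<rho>" using h \<rho> by simp
    finally have y1: "\<bar>y\<bar> \<le> \<rho>" .
    have w: "exp (- \<rho> * \<bar>x + h\<bar>) = exp (- \<rho> * \<bar>x\<bar>) * exp y"
      by (simp add: y_def exp_add[symmetric] algebra_simps)
    have "exp (- \<rho> * \<bar>x + h\<bar>) * p (x + h) - exp (- \<rho> * \<bar>x\<bar>) * p x
        = exp (- \<rho> * \<bar>x\<bar>) * (exp y * (p (x + h) - p x) + (exp y - 1) * p x)"
      unfolding w by (simp add: algebra_simps)
    then have "\<bar>exp (- \<rho> * \<bar>x + h\<bar>) * p (x + h) - exp (- \<rho> * \<bar>x\<bar>) * p x\<bar>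
        = exp (- \<rho> * \<bar>x\<bar>) * \<bar>exp y * (p (x + h) - p x) + (exp y - 1) * p x\<bar>"
      by (simp add: abs_mult)
    also have "\<dots> \<le> exp (- \<rho> * \<bar>x\<bar>) * (exp \<rho> * (L * h) + (\<rho> * h * exp \<rho>) * L)"
    proof (rule mult_left_mono)
      have "\<bar>exp y * (p (x + h) - p x)\<bar> \<le> exp \<rho> * (L * h)"
        unfolding abs_mult using elim y1 by (intro mult_mono) auto
      moreover have "\<bar>(exp y - 1) * p x\<bar> \<le> (\<rho> * h * exp \<rho>) * L"
      proof -
        have "\<bar>exp y - 1\<bar> \<le> \<bar>y\<bar> * exp \<bar>y\<bar>" by (rule abs_exp_minus_one_le)
        also have "\<dots> \<le> \<rho> * h * exp \<rho>" using y y1 \<rho> h by (intro mult_mono) auto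
        finally show ?thesis unfolding abs_mult using p(1)[of x] by (intro mult_mono) auto
      qed
      ultimately show "\<bar>exp y * (p (x + h) - p x) + (exp y - 1) * p x\<bar> \<le> exp \<rho> * (L * h) + (\<rho> * h * exp \<rho>) * L"
        by linarith
    qed simp
    also have "\<dots> = L * (exp \<rho> * (1 + \<rho>)) * h * exp (- \<rho> * \<bar>x\<bar>)" by (simp add: algebra_simps)
    finally show ?case .
  qed
qed

lemma wnorm_finite:
  fixes b :: "real \<Rightarrow> real"
  assumes b: "\<And>t. t \<ge> 0 \<Longrightarrow> \<bar>b t\<bar> \<le> E * exp (- \<delta> * t)" and \<rho>': "\<rho>' < \<delta>"
  shows "wnorm \<rho>' b < \<infinity>"
proof -
  have E: "E \<ge> 0" using b[of 0] by simp
  have "wnorm \<rho>' b \<le> ennreal E"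
    unfolding wnorm_def
  proof (rule SUP_least, rule ennreal_leI)
    fix t :: real assume "t \<in> {0..}"
    then have t: "t \<ge> 0" by simp
    have "exp (\<rho>' * t) * norm (b t) \<le> exp (\<rho>' * t) * (E * exp (- \<delta> * t))"
      using b[OF t] by (intro mult_left_mono) auto
    also have "\<dots> = E * exp (- ((\<delta> - \<rho>') * t))" by (simp add: exp_add[symmetric] algebra_simps)
    also have "\<dots> \<le> E * 1" using E \<rho>' t by (intro mult_left_mono) auto
    finally show "exp (\<rho>' * t) * norm (b t) \<le> E" by simp
  qed
  also have "\<dots> < \<infinity>" by simp
  finally show ?thesis .
qed

lemma is_theta_unique: "is_theta q \<rho> \<omega> \<theta> \<Longrightarrow> theta q \<rho> \<omega> = \<theta>"
  unfolding theta_def by (rule the_equality) (auto simp: is_theta_def)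

lemma is_theta_factorization:
  assumes V: "\<And>z. Re z > - s \<Longrightarrow> z + K q \<omega> z = (z + of_real \<theta>) * G z"
    and G: "G holomorphic_on {z. Re z > - s}" "\<And>z. Re z > - s \<Longrightarrow> G z \<noteq> 0"
    and s: "\<rho> / 2 < s" "\<theta> \<le> \<rho> / 2"
  shows "is_theta q \<rho> \<omega> \<theta>"
proof -
  let ?H = "{z. Re z > - s}" and ?p = "- complex_of_real \<theta>"
  have H: "open ?H" by (rule open_halfspace_Re_gt)
  have p: "?p \<in> ?H" using s by simp
  define g where "g z = 1 / G z" for z
  have g: "g holomorphic_on ?H" unfolding g_def using G by (intro holomorphic_intros) auto
  have gp: "g ?p \<noteq> 0" using G(2)[of ?p] p by (simp add: g_def)
  have Vg: "V q \<omega> z = g z / (z - ?p)" if "z \<in> ?H" for z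
    using V[of z] that by (simp add: V_def g_def mult.commute)
  have hol: "V q \<omega> holomorphic_on ?H - {?p}"
  proof -
    have "(\<lambda>z. g z / (z - ?p)) holomorphic_on ?H - {?p}"
      by (intro holomorphic_intros holomorphic_on_subset[OF g]) (auto simp: add_eq_0_iff)
    then show ?thesis by (rule holomorphic_transform) (use Vg in auto)
  qed
  have "is_pole (\<lambda>w. g w / (w - ?p) ^ 1) ?p"
    by (rule is_pole_basic[OF g H p gp]) simp
  then have pole: "is_pole (V q \<omega>) ?p"
    unfolding is_pole_def
  proof (rule filterlim_mono_eventually)
    show "\<forall>\<^sub>F w in at ?p. g w / (w - ?p) ^ 1 = V q \<omega> w"
      using eventually_at_in_open'[OF H p] by eventually_elim (simp add: Vg)
  qed auto
  have "\<not> is_pole (V q \<omega>) z" if "Re z \<ge> - \<rho> / 2" "z \<noteq> ?p" for z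
    by (rule not_is_pole_holomorphic[OF _ _ hol]) (use that s H in \<open>auto intro: open_delete\<close>)
  then have "{z. Re z \<ge> - \<rho> / 2 \<and> is_pole (V q \<omega>) z} = {?p}"
    using pole s by auto
  moreover have "isolated_singularity_at (V q \<omega>) ?p"
    by (rule isolated_singularity_at_holomorphic[OF hol H p])
  moreover have "zorder (V q \<omega>) ?p = -1"
    by (rule zorder_eqI[OF H p g gp]) (simp add: Vg power_int_minus divide_inverse)
  ultimately show ?thesis by (simp add: is_theta_def)
qed

context decaying_profile
begin

definition autocorr_const :: real where "autocorr_const = A * A * weight_mass"

lemma autocorr_kernel: "oscillating_kernel (corr q q) \<sigma> autocorr_const"
proof
  show "\<sigma> > 0" by (rule \<sigma>)
  show "continuous_on UNIV (corr q q)" by (rule continuous_corr[OF q_borel q_bound])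
  show "\<bar>corr q q t\<bar> \<le> autocorr_const * exp (- \<sigma> * t)" if "t \<ge> 0" for t
    using corr_bound[OF q_borel q_bound, of t] that by (simp add: autocorr_const_def)
  show "\<bar>corr q q (t + h) - corr q q t\<bar> \<le> autocorr_const * h * exp (- \<sigma> * t)" if "t \<ge> 0" "0 \<le> h" "h \<le> 1" for t h
  proof -
    have "autocorr_const \<ge> 0" using A_nonneg by (simp add: autocorr_const_def weight_mass_def)
    then have "autocorr_const * h * exp (- \<sigma> * \<bar>t + h\<bar>) \<le> autocorr_const * h * exp (- \<sigma> * t)"
      using that \<sigma> by (intro mult_left_mono) auto
    then show ?thesis using corr_Lipschitz[OF q_borel q_bound that(2,3), of t] by (simp add: autocorr_const_def)
  qed
qed

sublocale ker: oscillating_kernel "corr q q" \<sigma> autocorr_const by (rule autocorr_kernel)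

lemma autocorr_eq_corr:
  assumes "AE x in lebesgue. q0 x = q x"
  shows "autocorr q0 t = corr q q t"
proof -
  have "autocorr q0 t = (LINT x|lebesgue. q (x + t) * q x)"
    unfolding autocorr_def
  proof (rule lebesgue_integral_cong_AE)
    show "(\<lambda>x. q (x + t) * q x) \<in> borel_measurable lebesgue"
      by (intro measurable_completion) measurable
    show "AE x in lebesgue. q0 (x + t) * q0 x = q (x + t) * q x"
      using assms AE_lebesgue_shift[OF assms, of t] by eventually_elim (simp add: add.commute)
  qed
  also have "\<dots> = (LBINT x. q (x + t) * q x)" by (rule integral_completion) measurable
  also have "\<dots> = corr q q t"
    unfolding corr_def
    by (subst lborel_integral_real_affine[where c=1 and t="- t"]) (simp_all add: algebra_simps)
  finally show ?thesis .
qed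

lemma K_eq_laplace:
  assumes "AE x in lebesgue. q0 x = q x"
  shows "K q0 \<omega> z = laplace (ker.k \<omega>) z"
proof -
  have "(\<lambda>t. indicator {0..} t *\<^sub>R (exp (- z * of_real t) * complex_of_real (ker.k \<omega> t))) \<in> borel_measurable borel"
    by (intro borel_measurable_continuous_on_indicator continuous_intros ker.k_cont) auto
  then show ?thesis
    unfolding K_def laplace_def set_lebesgue_integral_def
    by (subst integral_completion[symmetric]) (simp_all add: autocorr_eq_corr[OF assms] ker.k_def)
qed

lemma Wiener_Khinchin:
  assumes q0: "AE x in lebesgue. q0 x = q x"
  shows "(LBINT t:{0..}. ker.k \<omega> t) = 2 * pi\<^sup>2 * (norm (fourier (\<lambda>x. of_real (q0 x)) \<omega>))\<^sup>2"
proof -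
  define P where "P = (LBINT x. cos (\<omega> * x) * q x)"
  define S where "S = (LBINT x. sin (\<omega> * x) * q x)"
  have qi: "integrable lborel (\<lambda>x. A * exp (- \<rho> * \<bar>x\<bar>))"
    by (intro integrable_mult_right exp_neg_abs_integrable \<rho>)
  have bdd: "integrable lborel (\<lambda>x. c x * q x)" if "c \<in> borel_measurable borel" "\<And>x. \<bar>c x\<bar> \<le> 1" for c :: "real \<Rightarrow> real"
  proof (rule Bochner_Integration.integrable_bound[OF qi])
    show "(\<lambda>x. c x * q x) \<in> borel_measurable lborel" using that by measurable
    have "\<bar>c x\<bar> * \<bar>q x\<bar> \<le> 1 * (A * exp (- \<rho> * \<bar>x\<bar>))" for x
      using that q_bound by (intro mult_mono) auto
    then show "AE x in lborel. norm (c x * q x) \<le> norm (A * exp (- \<rho> * \<bar>x\<bar>))"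
      by (auto simp: abs_mult A_nonneg)
  qed
  have Ci: "integrable lborel (\<lambda>x. cos (\<omega> * x) * q x)" and Si: "integrable lborel (\<lambda>x. sin (\<omega> * x) * q x)"
    by (rule bdd; simp)+
  define \<Phi> where "\<Phi> = (\<lambda>(t, x). cos (\<omega> * t) * (q x * q (x - t)))"
  have \<Phi>m[measurable]: "\<Phi> \<in> borel_measurable (lborel \<Otimes>\<^sub>M lborel)" unfolding \<Phi>_def by measurable
  define w where "w = (\<lambda>(t, x). A * A * (exp (- \<sigma> * \<bar>t\<bar>) * exp (- (\<rho> / 4) * \<bar>x\<bar>)))"
  have wi: "integrable (lborel \<Otimes>\<^sub>M lborel) w"
  proof (rule lborel_pair.Fubini_integrable)
    show "w \<in> borel_measurable (lborel \<Otimes>\<^sub>M lborel)" unfolding w_def by measurable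
    have "(LBINT x. norm (w (t, x))) = A * A * exp (- \<sigma> * \<bar>t\<bar>) * weight_mass" for t
      by (simp add: w_def weight_mass_def A_nonneg abs_mult mult.assoc[symmetric])
    then show "integrable lborel (\<lambda>t. LBINT x. norm (w (t, x)))"
      using exp_neg_abs_integrable[OF \<sigma>] by simp
    show "AE t in lborel. integrable lborel (\<lambda>x. w (t, x))"
      using exp_neg_abs_integrable[of "\<rho> / 4"] \<rho> by (simp add: w_def)
  qed
  have \<Phi>i: "integrable (lborel \<Otimes>\<^sub>M lborel) \<Phi>"
  proof (rule Bochner_Integration.integrable_bound[OF wi \<Phi>m])
    have "norm (\<Phi> (t, x)) \<le> norm (w (t, x))" for t x
    proof -
      have "norm (\<Phi> (t, x)) \<le> 1 * ((A * exp (- \<rho> * \<bar>x\<bar>)) * (A * exp (- \<rho> * \<bar>x - t\<bar>)))"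
        unfolding \<Phi>_def split real_norm_def abs_mult
        by (intro mult_mono q_bound) (auto simp: A_nonneg)
      also have "\<dots> = A * A * (exp (- \<rho> * \<bar>x\<bar>) * exp (- \<rho> * \<bar>x - t\<bar>))" by simp
      also have "\<dots> \<le> A * A * (exp (- \<sigma> * \<bar>t\<bar>) * exp (- (\<rho> / 4) * \<bar>x\<bar>))"
        using A_nonneg by (intro mult_left_mono weight_split) auto
      also have "\<dots> \<le> norm (w (t, x))" by (simp add: w_def)
      finally show ?thesis .
    qed
    then show "AE z in lborel \<Otimes>\<^sub>M lborel. norm (\<Phi> z) \<le> norm (w z)"
      by (intro AE_I2) (metis surj_pair)
  qed
  have "(LBINT t. ker.k \<omega> t) = (LBINT t. LBINT x. \<Phi> (t, x))"
    by (simp add: ker.k_def[abs_def] corr_def \<Phi>_def)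
  also have "\<dots> = (LBINT x. LBINT t. \<Phi> (t, x))"
    using lborel_pair.Fubini_integral[of "\<lambda>t x. \<Phi> (t, x)"] \<Phi>i by (simp add: case_prod_beta)
  also have "\<dots> = (LBINT x. P * (cos (\<omega> * x) * q x) + S * (sin (\<omega> * x) * q x))"
  proof (intro Bochner_Integration.integral_cong refl)
    fix x
    have "(LBINT t. \<Phi> (t, x)) = (LBINT y. cos (\<omega> * (x - y)) * (q x * q y))"
      by (subst lborel_integral_real_affine[where c="-1" and t=x]) (simp_all add: \<Phi>_def)
    also have "\<dots> = (LBINT y. (q x * cos (\<omega> * x)) * (cos (\<omega> * y) * q y) + (q x * sin (\<omega> * x)) * (sin (\<omega> * y) * q y))"
      by (intro Bochner_Integration.integral_cong refl) (simp add: right_diff_distrib cos_diff algebra_simps)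
    also have "\<dots> = (q x * cos (\<omega> * x)) * P + (q x * sin (\<omega> * x)) * S"
      using Bochner_Integration.integral_add[OF integrable_mult_right[OF Ci, of "q x * cos (\<omega> * x)"]
          integrable_mult_right[OF Si, of "q x * sin (\<omega> * x)"]]
      by (simp only: integral_mult_right_zero P_def S_def)
    finally show "(LBINT t. \<Phi> (t, x)) = P * (cos (\<omega> * x) * q x) + S * (sin (\<omega> * x) * q x)"
      by (simp add: mult_ac)
  qed
  also have "\<dots> = P * P + S * S"
    using Bochner_Integration.integral_add[OF integrable_mult_right[OF Ci, of P] integrable_mult_right[OF Si, of S]]
    by (simp only: integral_mult_right_zero P_def S_def)
  finally have full: "(LBINT t. ker.k \<omega> t) = P\<^sup>2 + S\<^sup>2" by (simp add: power2_eq_square)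
  have even: "ker.k \<omega> (- t) = ker.k \<omega> t" for t
  proof -
    have "corr q q (- t) = corr q q t"
      unfolding corr_def
      by (subst lborel_integral_real_affine[where c=1 and t="- t"]) (simp_all add: algebra_simps)
    then show ?thesis by (simp add: ker.k_def)
  qed
  have half: "set_integrable lborel {0..} (ker.k \<omega>)"
    by (rule set_integral_exp_bound(1)[OF \<sigma> set_borel_measurable_continuous_atLeast[OF ker.k_cont]])
      (use ker.k_bound in auto)
  define f where "f t = indicator {0..} t * ker.k \<omega> t" for t
  have fi: "integrable lborel f" using half by (simp add: set_integrable_def f_def[abs_def])
  have "(LBINT t. ker.k \<omega> t) = (LBINT t. f t + f (- t))"
  proof (rule integral_cong_AE)
    have [measurable]: "ker.k \<omega> \<in> borel_measurable borel"
      by (intro borel_measurable_continuous_onI ker.k_cont)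
    show "ker.k \<omega> \<in> borel_measurable lborel" by measurable
    show "(\<lambda>t. f t + f (- t)) \<in> borel_measurable lborel" unfolding f_def by measurable
    show "AE t in lborel. ker.k \<omega> t = f t + f (- t)"
      using AE_lborel_singleton[of "0::real"] by eventually_elim (auto simp: f_def even indicator_def)
  qed
  also have "\<dots> = (LBINT t. f t) + (LBINT t. f (- t))"
    using fi lborel_integrable_real_affine[OF fi, of "-1" 0] by (intro Bochner_Integration.integral_add) simp_all
  also have "(LBINT t. f (- t)) = (LBINT t. f t)"
    by (subst (2) lborel_integral_real_affine[where c="-1" and t=0]) simp_all
  finally have "2 * (LBINT t:{0..}. ker.k \<omega> t) = P\<^sup>2 + S\<^sup>2"
    using full by (simp add: set_lebesgue_integral_def f_def)
  moreover have "fourier (\<lambda>x. of_real (q0 x)) \<omega> = 1 / (2 * of_real pi) * Complex P (- S)"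
  proof -
    have "(LINT x|lebesgue. exp (- \<i> * of_real (\<omega> * x)) * of_real (q0 x))
        = (LINT x|lebesgue. of_real (cos (\<omega> * x) * q x) + (- \<i>) * of_real (sin (\<omega> * x) * q x))"
    proof (rule lebesgue_integral_cong_AE)
      show "(\<lambda>x. of_real (cos (\<omega> * x) * q x) + (- \<i>) * of_real (sin (\<omega> * x) * q x)) \<in> borel_measurable lebesgue"
        by (intro measurable_completion) measurable
      show "AE x in lebesgue. exp (- \<i> * of_real (\<omega> * x)) * of_real (q0 x)
          = of_real (cos (\<omega> * x) * q x) + (- \<i>) * of_real (sin (\<omega> * x) * q x)"
        using q0 by eventually_elim (simp add: complex_eq_iff Re_exp Im_exp)
    qed
    also have "\<dots> = (LBINT x. of_real (cos (\<omega> * x) * q x) + (- \<i>) * of_real (sin (\<omega> * x) * q x))"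
      by (rule integral_completion) measurable
    also have "\<dots> = of_real P + (- \<i>) * of_real S"
      using Bochner_Integration.integral_add[OF integrable_of_real[OF Ci] integrable_mult_right[OF integrable_of_real[OF Si], of "- \<i>"]]
      by (simp only: integral_mult_right_zero integral_complex_of_real P_def S_def)
    also have "\<dots> = Complex P (- S)" by (simp add: complex_eq_iff)
    finally show ?thesis by (simp add: fourier_def)
  qed
  then have "(norm (fourier (\<lambda>x. of_real (q0 x)) \<omega>))\<^sup>2 = (1 / (2 * pi))\<^sup>2 * (P\<^sup>2 + S\<^sup>2)"
    by (simp only: norm_mult norm_divide power_mult_distrib cmod_power2 complex.sel norm_of_real norm_one norm_numeral) simp
  ultimately show ?thesis
    by (simp add: power2_eq_square)
qed

end

definition resonance :: "(real \<Rightarrow> real) \<Rightarrow> real \<Rightarrow> real \<Rightarrow> real \<Rightarrow> real \<Rightarrow> bool" where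
  "resonance q \<rho> \<omega> r \<epsilon> \<longleftrightarrow>
       is_theta q \<rho> \<omega> (theta q \<rho> \<omega>) \<and>
       theta q \<rho> \<omega> = 2 * pi\<^sup>2 * (norm (fourier (\<lambda>x. of_real (q x)) \<omega>))\<^sup>2 * (1 + \<epsilon>) \<and>
       (\<forall>a\<^sub>0 \<psi> a. is_solution q \<omega> (\<lambda>x. 0) a\<^sub>0 \<psi> a \<longrightarrow>
          (\<exists>b :: real \<Rightarrow> real.
             (\<forall>t\<ge>0. a t = a\<^sub>0 * r * exp (- theta q \<rho> \<omega> * t) + b t) \<and>
             (\<forall>\<rho>'<\<rho> / 2. wnorm \<rho>' b < \<infinity>))) \<and>
       (\<forall>\<psi>\<^sub>0 a\<^sub>0. Linf (\<lambda>x. of_real (exp (\<rho> * \<bar>x\<bar>)) * \<psi>\<^sub>0 x) \<longrightarrow>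
          (\<exists>\<alpha> :: real. \<forall>\<psi> a. is_solution q \<omega> \<psi>\<^sub>0 a\<^sub>0 \<psi> a \<longrightarrow>
             (\<exists>b :: real \<Rightarrow> real.
                (\<forall>t\<ge>0. a t = \<alpha> * exp (- theta q \<rho> \<omega> * t) + b t) \<and>
                (\<forall>\<rho>'<\<rho> / 2. wnorm \<rho>' b < \<infinity>))))"

context decaying_profile
begin

lemma solution_asymptotics:
  assumes q0: "AE x in lebesgue. q0 x = q x" and \<omega>: "\<omega> \<ge> pi" "ker.osc_const / \<omega> \<le> \<sigma> / 12"
    and m: "\<And>t. (m has_real_derivative (- ker.k \<omega> t - \<theta> * m t)) (at t)" "m 0 = \<theta>"
    and mb: "\<And>t. t \<ge> 0 \<Longrightarrow> \<bar>m t\<bar> \<le> ker.osc_const / \<omega> * exp (- \<sigma> * t)" and \<theta>: "\<bar>\<theta>\<bar> \<le> ker.osc_const / \<omega>"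
    and f[measurable]: "f1 \<in> borel_measurable borel" "f2 \<in> borel_measurable borel"
    and f1: "\<And>x. \<bar>f1 x\<bar> \<le> B * exp (- \<rho> * \<bar>x\<bar>)" and f2: "\<And>x. \<bar>f2 x\<bar> \<le> B * exp (- \<rho> * \<bar>x\<bar>)"
    and \<psi>0: "AE x in lebesgue. \<psi>\<^sub>0 x = Complex (f1 x) (f2 x)"
    and sol: "is_solution q0 \<omega> \<psi>\<^sub>0 a\<^sub>0 \<psi> a"
  defines "g \<equiv> \<lambda>t. - (1 / \<omega>) * (cos (\<omega> * t) * corr f1 q t - sin (\<omega> * t) * corr f2 q t)"
  defines "\<alpha> \<equiv> (a\<^sub>0 + (LBINT s:{0..}. exp (\<theta> * s) * g s)) / (1 - (LBINT t:{0..}. exp (\<theta> * t) * m t))"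
  shows "\<exists>b. (\<forall>t\<ge>0. a t = \<alpha> * exp (- \<theta> * t) + b t) \<and> (\<forall>\<rho>'<\<rho> / 2. wnorm \<rho>' b < \<infinity>)"
proof -
  have \<omega>0: "\<omega> > 0" using \<omega>(1) pi_gt_zero by linarith
  have \<delta>: "\<sigma> - \<rho> / 2 = \<sigma> / 3" "0 < \<rho> / 2" "\<rho> / 2 < \<sigma>" using \<rho> by (auto simp: \<sigma>_def)
  have gc: "continuous_on {0..} g"
    unfolding g_def
    by (intro continuous_intros continuous_on_subset[OF continuous_corr[OF f(1) f1]]
        continuous_on_subset[OF continuous_corr[OF f(2) f2]]) auto
  define D where "D = 1 / \<omega> * (2 * (A * B * weight_mass))"
  have gb: "\<bar>g t\<bar> \<le> D * exp (- \<sigma> * t)" if t: "t \<ge> 0" for t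
  proof -
    have "\<bar>cos (\<omega> * t) * corr f1 q t - sin (\<omega> * t) * corr f2 q t\<bar>
        \<le> \<bar>cos (\<omega> * t)\<bar> * \<bar>corr f1 q t\<bar> + \<bar>sin (\<omega> * t)\<bar> * \<bar>corr f2 q t\<bar>"
      unfolding abs_mult[symmetric] by (rule abs_triangle_ineq4)
    also have "\<dots> \<le> 1 * (A * B * weight_mass * exp (- \<sigma> * \<bar>t\<bar>)) + 1 * (A * B * weight_mass * exp (- \<sigma> * \<bar>t\<bar>))"
      by (intro add_mono mult_mono corr_bound f f1 f2) auto
    finally have "1 / \<omega> * \<bar>cos (\<omega> * t) * corr f1 q t - sin (\<omega> * t) * corr f2 q t\<bar> \<le> 1 / \<omega> * (2 * (A * B * weight_mass * exp (- \<sigma> * t)))"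
      using \<omega>0 t by (intro mult_left_mono) auto
    then show ?thesis using \<omega>0 by (simp add: g_def D_def abs_mult mult_ac)
  qed
  have "\<exists>E. \<forall>t\<ge>0. \<bar>a t - (a 0 + (LBINT s:{0..}. exp (\<theta> * s) * g s)) / (1 - (LBINT t:{0..}. exp (\<theta> * t) * m t)) * exp (- \<theta> * t)\<bar>
      \<le> E * exp (- (\<rho> / 2) * t)"
  proof (rule volterra_asymptotics[OF \<delta>(2,3) _ m ker.k_cont mb _ gc gb])
    show "\<theta> \<le> \<rho> / 2" using order_trans[OF \<theta> \<omega>(2)] \<rho> by (simp add: \<sigma>_def abs_le_iff)
    show "ker.osc_const / \<omega> / (\<sigma> - \<rho> / 2) \<le> 1 / 2"
      unfolding \<delta>(1) using divide_right_mono[OF \<omega>(2), of "\<sigma> / 3"] \<sigma> by simp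
    show "(a has_real_derivative g t - integral {0..t} (\<lambda>s. ker.k \<omega> (t - s) * a s)) (at t within {0..})" if "t \<ge> 0" for t
      using solution_volterra[OF sol q0 _ f f1 f2 \<psi>0 that] \<omega>0
      by (auto simp: g_def ker.k_def intro: has_field_derivative_at_within)
  qed
  moreover have "a 0 = a\<^sub>0" using sol by (simp add: is_solution_def)
  ultimately obtain E where E: "\<And>t. t \<ge> 0 \<Longrightarrow> \<bar>a t - \<alpha> * exp (- \<theta> * t)\<bar> \<le> E * exp (- (\<rho> / 2) * t)"
    unfolding \<alpha>_def by auto
  show ?thesis
    by (rule exI[of _ "\<lambda>t. a t - \<alpha> * exp (- \<theta> * t)"]) (use wnorm_finite[OF E] in auto)
qed

lemma resonance_asymptotics:
  assumes q0: "AE x in lebesgue. q0 x = q x" and \<omega>: "\<omega> \<ge> pi" "ker.osc_const / \<omega> \<le> \<sigma> / 12"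
  shows "\<exists>r \<epsilon>. \<bar>\<epsilon>\<bar> \<le> 4 * ker.osc_const / \<sigma> / \<omega> \<and> \<bar>r - 1\<bar> \<le> 4 * ker.osc_const / \<sigma> / \<omega> \<and>
    resonance q0 \<rho> \<omega> r \<epsilon>"
proof -
  have \<omega>0: "\<omega> > 0" using \<omega>(1) pi_gt_zero by linarith
  obtain \<theta> where \<theta>: "\<theta> = (LBINT t:{0..}. exp (\<theta> * t) * ker.k \<omega> t)" "\<bar>\<theta>\<bar> \<le> ker.osc_const / \<omega>"
    using ker.decay_rate_exists[of \<omega>] \<omega> \<sigma> by auto
  then have \<theta>s: "\<bar>\<theta>\<bar> \<le> \<sigma> / 12" using \<omega>(2) by linarith
  obtain m where m: "\<And>t. (m has_real_derivative (- ker.k \<omega> t - \<theta> * m t)) (at t)" "m 0 = \<theta>"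
    and mb: "\<And>t. t \<ge> 0 \<Longrightarrow> \<bar>m t\<bar> \<le> ker.osc_const / \<omega> * exp (- \<sigma> * t)"
    using ker.memory_function_exists[OF \<omega>(1) \<theta>(1)] \<theta>s \<sigma> by auto
  have mc: "continuous_on S m" for S
    using m(1) by (meson DERIV_continuous continuous_at_imp_continuous_at_within continuous_on_eq_continuous_within)
  have lb: "norm (laplace m z) \<le> ker.osc_const / \<omega> / (Re z + \<sigma>)" if "Re z > - \<sigma>" for z
    using laplace_tail[OF mc mb that, of 0] by (simp add: laplace_def)
  have half: "norm (laplace m z) \<le> 1 / 2" if z: "Re z > - (5 / 6 * \<sigma>)" for z
  proof -
    have "Re z > - \<sigma>" using z \<sigma> by linarith
    then have "norm (laplace m z) \<le> ker.osc_const / \<omega> / (Re z + \<sigma>)" by (rule lb)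
    also have "\<dots> \<le> (\<sigma> / 12) / (\<sigma> / 6)" using z \<sigma> by (intro frac_le[OF _ \<omega>(2)]) linarith+
    also have "\<dots> = 1 / 2" using \<sigma> by simp
    finally show ?thesis .
  qed
  have fact: "z + K q0 \<omega> z = (z + of_real \<theta>) * (1 - laplace m z)" if "Re z > - \<sigma>" for z
    unfolding K_eq_laplace[OF q0] by (rule ker.laplace_factorization[OF m mb that])
  have "is_theta q0 \<rho> \<omega> \<theta>"
  proof (rule is_theta_factorization[where s = "5 / 6 * \<sigma>" and G = "\<lambda>z. 1 - laplace m z"])
    show "z + K q0 \<omega> z = (z + of_real \<theta>) * (1 - laplace m z)" if "- (5 / 6 * \<sigma>) < Re z" for z
      using fact[of z] that \<sigma> by simp
    show "(\<lambda>z. 1 - laplace m z) holomorphic_on {z. - (5 / 6 * \<sigma>) < Re z}"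
      by (intro holomorphic_intros holomorphic_on_subset[OF laplace_holomorphic[OF mc mb]]) (use \<sigma> in auto)
    show "1 - laplace m z \<noteq> 0" if "- (5 / 6 * \<sigma>) < Re z" for z
      using half[OF that] by auto
    show "\<rho> / 2 < 5 / 6 * \<sigma>" "\<theta> \<le> \<rho> / 2" using \<theta>s \<rho> by (auto simp: \<sigma>_def)
  qed
  then have theta: "is_theta q0 \<rho> \<omega> (theta q0 \<rho> \<omega>)" "theta q0 \<rho> \<omega> = \<theta>"
    using is_theta_unique by auto
  have inv: "\<bar>1 / (1 - x) - 1\<bar> \<le> 4 * ker.osc_const / \<sigma> / \<omega>" if "\<bar>x\<bar> \<le> ker.osc_const / \<omega> / (\<sigma> / 2)" for x
  proof -
    have "ker.osc_const / \<omega> / (\<sigma> / 2) \<le> (\<sigma> / 12) / (\<sigma> / 2)" using \<omega>(2) \<sigma> by (intro divide_right_mono) auto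
    also have "\<dots> \<le> 1 / 2" using \<sigma> by simp
    finally have x: "\<bar>x\<bar> \<le> 1 / 2" using that by linarith
    then have "1 / (1 - x) - 1 = x / (1 - x)" by (simp add: field_simps)
    then have "\<bar>1 / (1 - x) - 1\<bar> = \<bar>x\<bar> / (1 - x)" using x by simp
    also have "\<dots> \<le> (ker.osc_const / \<omega> / (\<sigma> / 2)) / (1 / 2)" using that x by (intro frac_le) auto
    also have "\<dots> = 4 * ker.osc_const / \<sigma> / \<omega>" by simp
    finally show ?thesis .
  qed
  have real: "laplace m (of_real x) = of_real (LBINT t:{0..}. exp (- x * t) * m t)" for x
    by (rule laplace_of_real)
  have small: "\<bar>LBINT t:{0..}. exp (- x * t) * m t\<bar> \<le> ker.osc_const / \<omega> / (\<sigma> / 2)" if x: "x \<ge> - (\<sigma> / 2)" for x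
  proof -
    have "norm (laplace m (of_real x)) \<le> ker.osc_const / \<omega> / (x + \<sigma>)" using lb[of "of_real x"] x \<sigma> by simp
    also have "\<dots> \<le> ker.osc_const / \<omega> / (\<sigma> / 2)"
      using ker.osc_const_nonneg \<omega>0 x \<sigma> by (intro divide_left_mono) auto
    finally show ?thesis unfolding real norm_of_real .
  qed
  define M0 where "M0 = (LBINT t:{0..}. exp (- 0 * t) * m t)"
  define \<epsilon> where "\<epsilon> = 1 / (1 - M0) - 1"
  have M0: "\<bar>M0\<bar> \<le> ker.osc_const / \<omega> / (\<sigma> / 2)" unfolding M0_def by (rule small) (use \<sigma> in simp)
  have "1 - M0 \<noteq> 0"
    using half[of 0] \<sigma> real[of 0] by (auto simp: M0_def)
  have "K q0 \<omega> 0 = of_real (LBINT t:{0..}. ker.k \<omega> t)"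
    using laplace_of_real[of "ker.k \<omega>" 0] by (simp add: K_eq_laplace[OF q0])
  moreover have "K q0 \<omega> 0 = of_real (\<theta> * (1 - M0))"
    using fact[of 0] real[of 0] \<sigma> by (simp add: M0_def)
  ultimately have "(LBINT t:{0..}. ker.k \<omega> t) = \<theta> * (1 - M0)"
    by (metis of_real_eq_iff)
  then have \<theta>_eq: "\<theta> = 2 * pi\<^sup>2 * (norm (fourier (\<lambda>x. of_real (q0 x)) \<omega>))\<^sup>2 * (1 + \<epsilon>)"
    using \<open>1 - M0 \<noteq> 0\<close> by (simp add: \<epsilon>_def Wiener_Khinchin[OF q0, symmetric])
  define \<mu> where "\<mu> = (LBINT t:{0..}. exp (\<theta> * t) * m t)"
  have \<mu>: "\<bar>\<mu>\<bar> \<le> ker.osc_const / \<omega> / (\<sigma> / 2)"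
    using small[of "- \<theta>"] \<theta>s \<sigma> by (simp add: \<mu>_def)
  note asym = solution_asymptotics[OF q0 \<omega> m mb \<theta>(2)]
  have part1: "\<exists>b. (\<forall>t\<ge>0. a t = a\<^sub>0 * (1 / (1 - \<mu>)) * exp (- \<theta> * t) + b t) \<and> (\<forall>\<rho>'<\<rho> / 2. wnorm \<rho>' b < \<infinity>)"
    if sol: "is_solution q0 \<omega> (\<lambda>x. 0) a\<^sub>0 \<psi> a" for a\<^sub>0 \<psi> a
    using asym[of "\<lambda>x. 0" "\<lambda>x. 0" 0 "\<lambda>x. 0", OF _ _ _ _ _ _ sol]
    by (simp add: corr_def \<mu>_def set_lebesgue_integral_def zero_complex.code[symmetric])
  have part2: "\<exists>\<alpha>. \<forall>\<psi> a. is_solution q0 \<omega> \<psi>\<^sub>0 a\<^sub>0 \<psi> a \<longrightarrow>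
      (\<exists>b. (\<forall>t\<ge>0. a t = \<alpha> * exp (- \<theta> * t) + b t) \<and> (\<forall>\<rho>'<\<rho> / 2. wnorm \<rho>' b < \<infinity>))"
    if Linf: "Linf (\<lambda>x. of_real (exp (\<rho> * \<bar>x\<bar>)) * \<psi>\<^sub>0 x)" for \<psi>\<^sub>0 :: "real \<Rightarrow> complex" and a\<^sub>0
  proof -
    let ?w = "\<lambda>x. complex_of_real (exp (\<rho> * \<bar>x\<bar>)) * \<psi>\<^sub>0 x"
    from Linf obtain C where w: "?w \<in> borel_measurable lebesgue" "AE x in lebesgue. norm (?w x) \<le> C"
      by (auto simp: Linf_def)
    have L1: "Linf (\<lambda>x. Re (?w x))" unfolding Linf_def
    proof
      show "(\<lambda>x. Re (?w x)) \<in> borel_measurable lebesgue" using w(1) by measurable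
      show "\<exists>C. AE x in lebesgue. norm (Re (?w x)) \<le> C"
        by (rule exI[of _ C], use w(2) in eventually_elim) (metis abs_Re_le_cmod order_trans real_norm_def)
    qed
    have L2: "Linf (\<lambda>x. Im (?w x))" unfolding Linf_def
    proof
      show "(\<lambda>x. Im (?w x)) \<in> borel_measurable lebesgue" using w(1) by measurable
      show "\<exists>C. AE x in lebesgue. norm (Im (?w x)) \<le> C"
        by (rule exI[of _ C], use w(2) in eventually_elim) (metis abs_Im_le_cmod order_trans real_norm_def)
    qed
    obtain p1 B1 where p1: "p1 \<in> borel_measurable borel" "AE x in lebesgue. Re (?w x) = p1 x" "\<And>x. \<bar>p1 x\<bar> \<le> B1" "B1 \<ge> 0"
      using Linf_borel_representative[OF L1] by blast
    obtain p2 B2 where p2: "p2 \<in> borel_measurable borel" "AE x in lebesgue. Im (?w x) = p2 x" "\<And>x. \<bar>p2 x\<bar> \<le> B2" "B2 \<ge> 0"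
      using Linf_borel_representative[OF L2] by blast
    note [measurable] = p1(1) p2(1)
    define f1 where "f1 x = exp (- \<rho> * \<bar>x\<bar>) * p1 x" for x
    define f2 where "f2 x = exp (- \<rho> * \<bar>x\<bar>) * p2 x" for x
    define B where "B = max B1 B2"
    have pB: "\<bar>p1 x\<bar> \<le> B" "\<bar>p2 x\<bar> \<le> B" for x
      using p1(3)[of x] p2(3)[of x] by (auto simp: B_def)
    have f: "f1 \<in> borel_measurable borel" "f2 \<in> borel_measurable borel"
      unfolding f1_def[abs_def] f2_def[abs_def] by measurable
    have fb: "\<bar>f1 x\<bar> \<le> B * exp (- \<rho> * \<bar>x\<bar>)" "\<bar>f2 x\<bar> \<le> B * exp (- \<rho> * \<bar>x\<bar>)" for x
      using pB[of x] by (simp_all add: f1_def f2_def abs_mult mult.commute)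
    have \<psi>0: "AE x in lebesgue. \<psi>\<^sub>0 x = Complex (f1 x) (f2 x)"
      using p1(2) p2(2)
    proof eventually_elim
      case (elim x)
      have "exp (- \<rho> * \<bar>x\<bar>) * (exp (\<rho> * \<bar>x\<bar>) * y) = y" for y by (simp add: exp_minus)
      then show ?case using elim by (simp add: f1_def f2_def complex_eq_iff flip: elim)
    qed
    show ?thesis using asym[OF _ f fb \<psi>0] by blast
  qed
  have "resonance q0 \<rho> \<omega> (1 / (1 - \<mu>)) \<epsilon>"
    unfolding resonance_def theta(2)
    using theta(1)[unfolded theta(2)] \<theta>_eq part1 part2 by blast
  then show ?thesis
  proof (intro exI conjI)
    show "\<bar>\<epsilon>\<bar> \<le> 4 * ker.osc_const / \<sigma> / \<omega>" unfolding \<epsilon>_def by (rule inv[OF M0])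
    show "\<bar>1 / (1 - \<mu>) - 1\<bar> \<le> 4 * ker.osc_const / \<sigma> / \<omega>" by (rule inv[OF \<mu>])
  qed
qed

end

theorem theorem3p2:
  fixes q :: "real \<Rightarrow> real" and \<rho> :: real
  assumes "\<rho> > 0"
    and "W1inf (\<lambda>x. exp (\<rho> * \<bar>x\<bar>) * q x)"
  shows "\<exists>r \<epsilon> :: real \<Rightarrow> real.
    \<epsilon> \<in> O(\<lambda>\<omega>. 1 / \<omega>) \<and> (\<lambda>\<omega>. r \<omega> - 1) \<in> O(\<lambda>\<omega>. 1 / \<omega>) \<and>
    (\<forall>\<^sub>F \<omega> in at_top.
       is_theta q \<rho> \<omega> (theta q \<rho> \<omega>) \<and>
       theta q \<rho> \<omega> = 2 * pi\<^sup>2 * (norm (fourier (\<lambda>x. of_real (q x)) \<omega>))\<^sup>2 * (1 + \<epsilon> \<omega>) \<and>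
       (\<forall>a\<^sub>0 \<psi> a. is_solution q \<omega> (\<lambda>x. 0) a\<^sub>0 \<psi> a \<longrightarrow>
          (\<exists>b :: real \<Rightarrow> real.
             (\<forall>t\<ge>0. a t = a\<^sub>0 * r \<omega> * exp (- theta q \<rho> \<omega> * t) + b t) \<and>
             (\<forall>\<rho>'<\<rho> / 2. wnorm \<rho>' b < \<infinity>))) \<and>
       (\<forall>\<psi>\<^sub>0 a\<^sub>0. Linf (\<lambda>x. of_real (exp (\<rho> * \<bar>x\<bar>)) * \<psi>\<^sub>0 x) \<longrightarrow>
          (\<exists>\<alpha> :: real. \<forall>\<psi> a. is_solution q \<omega> \<psi>\<^sub>0 a\<^sub>0 \<psi> a \<longrightarrow>
             (\<exists>b :: real \<Rightarrow> real.
                (\<forall>t\<ge>0. a t = \<alpha> * exp (- theta q \<rho> \<omega> * t) + b t) \<and>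
                (\<forall>\<rho>'<\<rho> / 2. wnorm \<rho>' b < \<infinity>)))))"
proof -
  obtain p L where p: "p \<in> borel_measurable borel" "AE x in lebesgue. exp (\<rho> * \<bar>x\<bar>) * q x = p x"
    "\<And>x. \<bar>p x\<bar> \<le> L" "\<And>h. h \<ge> 0 \<Longrightarrow> AE x in lborel. \<bar>p (x + h) - p x\<bar> \<le> L * h"
    using W1inf_Lipschitz_representative[OF assms(2)] by blast
  interpret decaying_profile "\<lambda>x. exp (- \<rho> * \<bar>x\<bar>) * p x" \<rho> "L * (exp \<rho> * (1 + \<rho>))"
    by (rule decaying_profile_exp_weight[OF assms(1) p(1,3,4)])
  have q0: "AE x in lebesgue. q x = exp (- \<rho> * \<bar>x\<bar>) * p x"
    using p(2)
  proof eventually_elim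
    case (elim x)
    then show ?case by (simp add: exp_minus flip: elim)
  qed
  define \<omega>0 where "\<omega>0 = max pi (12 * ker.osc_const / \<sigma>)"
  have large: "\<omega> \<ge> pi" "ker.osc_const / \<omega> \<le> \<sigma> / 12" if "\<omega> \<ge> \<omega>0" for \<omega>
  proof -
    show "\<omega> \<ge> pi" using that by (simp add: \<omega>0_def)
    then have "\<omega> > 0" using pi_gt_zero by linarith
    moreover have "12 * ker.osc_const / \<sigma> \<le> \<omega>" using that by (simp add: \<omega>0_def)
    ultimately show "ker.osc_const / \<omega> \<le> \<sigma> / 12" using \<sigma> by (simp add: field_simps)
  qed
  have "\<forall>\<omega>. \<exists>r \<epsilon>. \<omega> \<ge> \<omega>0 \<longrightarrow> \<bar>\<epsilon>\<bar> \<le> 4 * ker.osc_const / \<sigma> / \<omega> \<and> \<bar>r - 1\<bar> \<le> 4 * ker.osc_const / \<sigma> / \<omega> \<and> resonance q \<rho> \<omega> r \<epsilon>"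
    using resonance_asymptotics[OF q0 large] by blast
  then obtain r \<epsilon> where P: "\<omega> \<ge> \<omega>0 \<Longrightarrow>
      \<bar>\<epsilon> \<omega>\<bar> \<le> 4 * ker.osc_const / \<sigma> / \<omega> \<and> \<bar>r \<omega> - 1\<bar> \<le> 4 * ker.osc_const / \<sigma> / \<omega> \<and> resonance q \<rho> \<omega> (r \<omega>) (\<epsilon> \<omega>)" for \<omega>
    by metis
  have O: "f \<in> O(\<lambda>\<omega>. 1 / \<omega>)" if "\<And>\<omega>. \<omega> \<ge> \<omega>0 \<Longrightarrow> \<bar>f \<omega>\<bar> \<le> 4 * ker.osc_const / \<sigma> / \<omega>" for f :: "real \<Rightarrow> real"
  proof (rule bigoI)
    show "\<forall>\<^sub>F \<omega> in at_top. norm (f \<omega>) \<le> 4 * ker.osc_const / \<sigma> * norm (1 / \<omega>)"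
      using eventually_ge_at_top[of \<omega>0]
    proof eventually_elim
      case (elim \<omega>)
      then have "\<omega> > 0" using large(1)[OF elim] pi_gt_zero by linarith
      then show ?case using that[OF elim] by simp
    qed
  qed
  show ?thesis
    unfolding resonance_def[symmetric]
  proof (intro exI conjI)
    show "\<epsilon> \<in> O(\<lambda>\<omega>. 1 / \<omega>)" "(\<lambda>\<omega>. r \<omega> - 1) \<in> O(\<lambda>\<omega>. 1 / \<omega>)"
      using P by (auto intro!: O)
    show "\<forall>\<^sub>F \<omega> in at_top. resonance q \<rho> \<omega> (r \<omega>) (\<epsilon> \<omega>)"
      using eventually_ge_at_top[of \<omega>0] by eventually_elim (use P in blast)
  qed
qed

end
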